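(* There exist constants $c,C>0$ such that for all integers $N\ge 2$, $$c\log N\le \alpha(N)\le C\log N .$$ In particular, $\alpha(N)\to\infty$ as $N$ tends to infinity. Here $$\alpha(N)=\inf\Big\{\|N\Delta b\|_d^2+\|N\Delta(\mathcal{F}_d b)\|_d^2\Big\},$$ where $d=N^2$ and the infimum is taken over all $b\in \ell_2^d$ for which the Gabor system $G_d(b)$ is an orthonormal basis of $\ell_2^d$.
   Context: For $N\in\mathbb{N}$ put $d=N^2$ and $\mathbb{Z}_d=\mathbb{Z}/d\mathbb{Z}$. $\ell_2^d$ is the space of all functions $b:\mathbb{Z}_d\to\mathbb{C}$ with norm $\|b\|_d^2=\frac1N\sum_{j=0}^{d-1}|b(j)|^2$ (and the corresponding inner product $\frac1N\sum_{j=0}^{d-1} a(j)\overline{b(j)}$). The finite Fourier transform is $\mathcal{F}_d(b)(k)=\frac1N\sum_{j=0}^{d-1}b(j)e^{-2\pi i jk/d}$, which is unitary on $\ell_2^d$. The discrete derivative is $\Delta b(j)=b(j+1)-b(j)$, $j\in\mathbb{Z}_d$ (indices modulo $d$). Let $N\mathbb{Z}_d$ denote the set $\{Nk:k\in\mathbb{Z}\}$ modulo $d$. The Gabor system generated by $b\in\ell_2^d$ is $$G_d(b)=\{e^{2\pi i \ell j/d}\,b(j-k)\}_{(k,\ell)\in (N\mathbb{Z}_d)^2},$$ where each element is viewed as a function of $j\in\mathbb{Z}_d$. *)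

theory Defs
  imports Complex_Main
begin

text \<open>
  Throughout, $d = N^2$. A function on $\mathbb{Z}/d\mathbb{Z}$ is represented by a $d$-periodic
  function on the integers, and the notions that depend on $d$ take $N$ as their parameter.
\<close>

definition ell2 :: "nat \<Rightarrow> (int \<Rightarrow> complex) set" where
  "ell2 N = {b. \<forall>j. b (j + int (N^2)) = b j}"

definition inner_d :: "nat \<Rightarrow> (int \<Rightarrow> complex) \<Rightarrow> (int \<Rightarrow> complex) \<Rightarrow> complex" where
  "inner_d N a b = (1 / of_nat N) * (\<Sum>j\<in>{0..<int (N^2)}. a j * cnj (b j))"

definition norm_d :: "nat \<Rightarrow> (int \<Rightarrow> complex) \<Rightarrow> real" where
  "norm_d N b = sqrt ((1 / real N) * (\<Sum>j\<in>{0..<int (N^2)}. (cmod (b j))^2))"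

definition fourier_d :: "nat \<Rightarrow> (int \<Rightarrow> complex) \<Rightarrow> (int \<Rightarrow> complex)" where
  "fourier_d N b = (\<lambda>k. (1 / of_nat N) * (\<Sum>j\<in>{0..<int (N^2)}.
      b j * exp (- (2 * of_real pi * \<i> * of_int j * of_int k / of_nat (N^2)))))"

definition Delta :: "(int \<Rightarrow> complex) \<Rightarrow> (int \<Rightarrow> complex)" where
  "Delta b = (\<lambda>j. b (j + 1) - b j)"

text \<open>The set $N\mathbb{Z}_d$, each residue class being given by its representative in $[0,d)$.\<close>

definition NZ :: "nat \<Rightarrow> int set" where
  "NZ N = {(int N * k) mod int (N^2) | k. True}"

definition gabor :: "nat \<Rightarrow> (int \<Rightarrow> complex) \<Rightarrow> int \<times> int \<Rightarrow> (int \<Rightarrow> complex)" where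
  "gabor N b = (\<lambda>(k, l) j.
      exp (2 * of_real pi * \<i> * of_int l * of_int j / of_nat (N^2)) * b (j - k))"

text \<open>
  Bases are indexed families. The space is finite-dimensional, so completeness of the family means
  that every vector is a linear combination of its members.
\<close>

definition orthonormal_basis_d :: "nat \<Rightarrow> 'i set \<Rightarrow> ('i \<Rightarrow> int \<Rightarrow> complex) \<Rightarrow> bool" where
  "orthonormal_basis_d N I g \<longleftrightarrow>
     finite I \<and>
     (\<forall>x\<in>I. g x \<in> ell2 N) \<and>
     (\<forall>x\<in>I. \<forall>y\<in>I. inner_d N (g x) (g y) = (if x = y then 1 else 0)) \<and>
     (\<forall>a\<in>ell2 N. \<exists>c :: 'i \<Rightarrow> complex. \<forall>j. a j = (\<Sum>x\<in>I. c x * g x j))"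

text \<open>
  The set below is bounded below by 0, and for \<open>N \<ge> 1\<close> it is non-empty (the periodised indicator
  function of $\{0,\dots,N-1\}$ generates an orthonormal basis), so the infimum over the reals is
  the intended one.
\<close>

definition alpha :: "nat \<Rightarrow> real" where
  "alpha N = Inf {(norm_d N (\<lambda>j. of_nat N * Delta b j))^2
                + (norm_d N (\<lambda>k. of_nat N * Delta (fourier_d N b) k))^2 | b.
       b \<in> ell2 N \<and> orthonormal_basis_d N (NZ N \<times> NZ N) (gabor N b)}"

end

theory Submission
  imports Defs "HOL-Analysis.L2_Norm" "HOL-Analysis.Harmonic_Numbers"
begin

text \<open>
  The Zak transform \<open>X m n = (\<Sum>k. b (m - N k) exp (2 \<pi> i k n / N))\<close> turns the basis property into
  \<open>|X| = 1\<close>. It is \<open>N\<close>-periodic in \<open>n\<close> and picks up the factor \<open>exp (2 \<pi> i n / N)\<close> under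
  \<open>m \<mapsto> m + N\<close>, and the Fourier transform of \<open>b\<close> has the Zak transform
  \<open>exp (2 \<pi> i m n / N\<^sup>2) X (-n) m\<close>. So the functional to be minimised is the Dirichlet energy of a
  unimodular function whose quasi-periodicity forces a vortex, and such energies are logarithmic.

  Lower bound: every grid of \<open>M \<times> M\<close> nearly equally spaced points in a period cell must contain a jump
  of unit size, hence, on the unit circle, a second difference of unit size. Averaging over all
  translates of the grid bounds the second difference energy at step \<open>N / M\<close> from below by
  \<open>N\<^sup>2 / M\<^sup>2\<close> up to a constant. By the parallelogram law the second difference energy at step \<open>s\<close> is
  \<open>4 D s - D (2 s)\<close>, where \<open>D\<close> is the first difference energy, so the dyadic scales telescope and each
  of them contributes a fixed amount to \<open>D 1\<close>.

  Upper bound: normalise \<open>(1 - x) + x exp (2 \<pi> i y)\<close>, which has one zero in the unit cell, sample it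
  on the grid of mesh \<open>1 / N\<close> and invert the Zak transform.
\<close>

subsection \<open>Periodic sums and the discrete Fourier transform\<close>

text \<open>The argument counts full turns, so every kernel below is \<open>ec\<close> of a rational
  number and integer summands drop out.\<close>

definition ec :: "real \<Rightarrow> complex" where
  "ec t = cis (2 * pi * t)"

lemma ec_0 [simp]: "ec 0 = 1"
  by (simp add: ec_def)

lemma ec_add: "ec (s + t) = ec s * ec t"
  by (simp add: ec_def cis_mult ring_distribs)

lemma ec_of_int [simp]: "ec (of_int n) = 1"
  by (metis cis_2pi cis_power_int cis_zero ec_def mult.commute power_int_1_left)

lemma norm_ec [simp]: "cmod (ec t) = 1"
  by (simp add: ec_def)

lemma cnj_ec: "cnj (ec t) = ec (- t)"
  by (simp add: ec_def cis_cnj)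

lemma ec_eq_1_iff: "ec t = 1 \<longleftrightarrow> (\<exists>n::int. t = of_int n)"
proof
  assume "ec t = 1"
  then have "cos (2 * pi * t) = 1"
    by (metis cis.sel(1) ec_def one_complex.sel(1))
  then show "\<exists>n::int. t = of_int n"
    by (auto simp: cos_one_2pi_int)
qed auto

lemma ec_add_int: "ec (t + of_int n) = ec t"
  by (simp add: ec_add)

lemma exp_eq_ec: "exp (2 * of_real pi * \<i> * of_int j * of_int k / of_nat n)
    = ec (of_int j * of_int k / of_nat n)"
  by (simp add: ec_def cis_conv_exp mult_ac)

lemma periodic_add_mult:
  fixes f :: "int \<Rightarrow> 'a"
  assumes "\<And>j. f (j + P) = f j"
  shows "f (j + P * k) = f j"
proof (induction k rule: int_induct[where k = 0])
  case (step1 i)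
  then show ?case using assms[of "j + P * i"] by (simp add: algebra_simps)
next
  case (step2 i)
  then show ?case using assms[of "j + P * (i - 1)"] by (simp add: algebra_simps)
qed simp

lemma periodic_mod:
  fixes f :: "int \<Rightarrow> 'a"
  assumes "\<And>j. f (j + P) = f j"
  shows "f (j mod P) = f j"
  using periodic_add_mult[of f P "j mod P" "j div P", OF assms] by (simp add: add.commute)

lemma sum_periodic_shift:
  fixes f :: "int \<Rightarrow> 'a::comm_monoid_add"
  assumes "P > 0" and per: "\<And>j. f (j + P) = f j"
  shows "(\<Sum>j\<in>{0..<P}. f (j + a)) = (\<Sum>j\<in>{0..<P}. f j)"
proof (rule sum.reindex_bij_witness[of _ "\<lambda>j. (j - a) mod P" "\<lambda>j. (j + a) mod P"])
  fix j assume "j \<in> {0..<P}"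
  then show "((j + a) mod P - a) mod P = j" and "((j - a) mod P + a) mod P = j"
    by (simp_all add: mod_simps)
  show "f ((j + a) mod P) = f (j + a)"
    by (rule periodic_mod) (rule per)
qed (use \<open>P > 0\<close> in auto)

lemma sum_periodic_reflect:
  fixes f :: "int \<Rightarrow> 'a::comm_monoid_add"
  assumes "P > 0" and per: "\<And>j. f (j + P) = f j"
  shows "(\<Sum>j\<in>{0..<P}. f (a - j)) = (\<Sum>j\<in>{0..<P}. f j)"
proof (rule sum.reindex_bij_witness[of _ "\<lambda>j. (a - j) mod P" "\<lambda>j. (a - j) mod P"])
  fix j assume "j \<in> {0..<P}"
  then show "(a - (a - j) mod P) mod P = j"
    by (simp add: mod_simps)
  then show "(a - (a - j) mod P) mod P = j" .
  show "f ((a - j) mod P) = f (a - j)"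
    by (rule periodic_mod) (rule per)
qed (use \<open>P > 0\<close> in auto)

text \<open>Residues modulo \<open>N^2\<close> are parametrised as \<open>m - N q\<close>; the minus
  sign, obtained by reflecting \<open>q\<close>, is the one in the Zak transform.\<close>

lemma sum_residues_split:
  fixes f :: "int \<Rightarrow> 'a::comm_monoid_add"
  assumes "N > 0" and per: "\<And>j. f (j + int (N^2)) = f j"
  shows "(\<Sum>j\<in>{0..<int (N^2)}. f j) = (\<Sum>m\<in>{0..<int N}. \<Sum>q\<in>{0..<int N}. f (m - int N * q))"
proof -
  have bound: "m + int N * q < int (N^2)" if "m \<in> {0..<int N}" "q \<in> {0..<int N}" for m q
  proof -
    have "int N * q \<le> int N * (int N - 1)"
      using that by (intro mult_left_mono) auto
    then show ?thesis
      using that by (simp add: power2_eq_square algebra_simps)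
  qed
  have "(\<Sum>j\<in>{0..<int (N^2)}. f j)
      = (\<Sum>(m, q)\<in>{0..<int N} \<times> {0..<int N}. f (m + int N * q))"
  proof (rule sum.reindex_bij_witness[of _ "\<lambda>(m, q). m + int N * q" "\<lambda>j. (j mod int N, j div int N)"])
    fix j assume j: "j \<in> {0..<int (N^2)}"
    have "j div int N < int N"
    proof (rule ccontr)
      assume "\<not> ?thesis"
      then have "int N * int N \<le> int N * (j div int N)"
        by (intro mult_left_mono) auto
      also have "\<dots> \<le> j"
        using \<open>N > 0\<close> by (simp add: minus_mod_eq_mult_div[symmetric])
      finally show False using j by (simp add: power2_eq_square)
    qed
    then show "(j mod int N, j div int N) \<in> {0..<int N} \<times> {0..<int N}"
      using j \<open>N > 0\<close> by (auto simp: pos_imp_zdiv_nonneg_iff)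
  qed (use \<open>N > 0\<close> bound in auto)
  also have "\<dots> = (\<Sum>m\<in>{0..<int N}. \<Sum>q\<in>{0..<int N}. f (m + int N * q))"
    by (simp add: sum.cartesian_product)
  also have "\<dots> = (\<Sum>m\<in>{0..<int N}. \<Sum>q\<in>{0..<int N}. f (m + int N * (0 - q)))"
  proof (rule sum.cong[OF refl])
    fix m :: int
    have "f (m + int N * (j + int N)) = f (m + int N * j)" for j
      using per[of "m + int N * j"] by (simp add: algebra_simps power2_eq_square)
    then show "(\<Sum>q\<in>{0..<int N}. f (m + int N * q)) = (\<Sum>q\<in>{0..<int N}. f (m + int N * (0 - q)))"
      using \<open>N > 0\<close> sum_periodic_reflect[of "int N" "\<lambda>q. f (m + int N * q)" 0] by simp
  qed
  finally show ?thesis by simp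
qed

text \<open>Advancing \<open>k\<close> by one permutes the summands and multiplies the sum by
  \<open>ec (n / N)\<close>, so the sum vanishes unless that factor is 1.\<close>

lemma sum_ec:
  assumes "N > 0"
  shows "(\<Sum>k\<in>{0..<int N}. ec (of_int k * of_int n / of_nat N)) = (if int N dvd n then of_nat N else 0)"
proof (cases "int N dvd n")
  case True
  then obtain q where q: "n = int N * q" by blast
  have "ec (of_int k * of_int n / of_nat N) = 1" for k
  proof -
    have "(of_int k * of_int n / of_nat N :: real) = of_int (k * q)"
      using \<open>N > 0\<close> by (simp add: q)
    then show ?thesis by (metis ec_of_int)
  qed
  then show ?thesis using True by simp
next
  case False
  let ?S = "\<Sum>k\<in>{0..<int N}. ec (of_int k * of_int n / of_nat N)"
  have "?S = (\<Sum>k\<in>{0..<int N}. ec (of_int (k + 1) * of_int n / of_nat N))"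
  proof (rule sum_periodic_shift[symmetric])
    fix k :: int
    have "(of_int (k + int N) * of_int n / of_nat N :: real) = of_int k * of_int n / of_nat N + of_int n"
      using \<open>N > 0\<close> by (simp add: field_simps)
    then show "ec (of_int (k + int N) * of_int n / of_nat N) = ec (of_int k * of_int n / of_nat N)"
      by (simp add: ec_add)
  qed (use \<open>N > 0\<close> in auto)
  also have "\<dots> = ec (of_int n / of_nat N) * ?S"
    by (simp add: sum_distrib_left ec_add ring_distribs add_divide_distrib mult.commute)
  finally have "(ec (of_int n / of_nat N) - 1) * ?S = 0"
    by (simp add: algebra_simps)
  moreover have "ec (of_int n / of_nat N) \<noteq> 1"
  proof
    assume "ec (of_int n / of_nat N) = 1"
    then obtain q :: int where "of_int n / of_nat N = (of_int q :: real)"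
      using ec_eq_1_iff by blast
    then have "(of_int n :: real) = of_int (int N * q)"
      using \<open>N > 0\<close> by (simp add: field_simps)
    then have "n = int N * q"
      by (rule of_int_eq_iff[THEN iffD1])
    then show False using False by simp
  qed
  ultimately show ?thesis using False by simp
qed

lemma dvd_diff_residues_iff:
  assumes "k \<in> {0..<int N}" "k' \<in> {0..<int N}"
  shows "int N dvd k - k' \<longleftrightarrow> k = k'"
  using assms by (simp add: mod_eq_dvd_iff[symmetric])

text \<open>Orthogonality of characters: after exchanging the sums only \<open>k' = k\<close>
  survives.\<close>

lemma dft_inversion:
  fixes f :: "int \<Rightarrow> complex"
  assumes "N > 0" "k \<in> {0..<int N}"
  shows "(\<Sum>n\<in>{0..<int N}. ec (- (of_int n * of_int k / of_nat N)) *
      (\<Sum>k'\<in>{0..<int N}. ec (of_int k' * of_int n / of_nat N) * f k')) = of_nat N * f k"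
proof -
  have *: "ec (- (of_int n * of_int k / of_nat N)) * ec (of_int k' * of_int n / of_nat N)
      = ec (of_int n * of_int (k' - k) / of_nat N)" for n k'
    by (simp add: ec_add[symmetric] ring_distribs diff_divide_distrib mult.commute)
  have "(\<Sum>n\<in>{0..<int N}. ec (- (of_int n * of_int k / of_nat N)) *
      (\<Sum>k'\<in>{0..<int N}. ec (of_int k' * of_int n / of_nat N) * f k'))
    = (\<Sum>n\<in>{0..<int N}. \<Sum>k'\<in>{0..<int N}. ec (of_int n * of_int (k' - k) / of_nat N) * f k')"
    by (simp add: sum_distrib_left mult.assoc[symmetric] *)
  also have "\<dots> = (\<Sum>k'\<in>{0..<int N}. (\<Sum>n\<in>{0..<int N}. ec (of_int n * of_int (k' - k) / of_nat N)) * f k')"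
    by (subst sum.swap) (simp add: sum_distrib_right)
  also have "\<dots> = (\<Sum>k'\<in>{0..<int N}. if k' = k then of_nat N * f k else 0)"
    using assms by (intro sum.cong refl) (auto simp: sum_ec dvd_diff_residues_iff simp del: of_int_diff)
  also have "\<dots> = of_nat N * f k"
    using assms by (subst sum.delta) auto
  finally show ?thesis .
qed

text \<open>The conjugate factor of \<open>|F n|^2\<close> is expanded, and the inversion formula
  then evaluates the sum over \<open>n\<close>.\<close>

lemma dft_parseval:
  fixes f :: "int \<Rightarrow> complex"
  assumes "N > 0"
  shows "(\<Sum>n\<in>{0..<int N}. (cmod (\<Sum>k\<in>{0..<int N}. ec (of_int k * of_int n / of_nat N) * f k))^2)
    = of_nat N * (\<Sum>k\<in>{0..<int N}. (cmod (f k))^2)"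
proof -
  define F where "F n = (\<Sum>k\<in>{0..<int N}. ec (of_int k * of_int n / of_nat N) * f k)" for n
  have cF: "cnj (F n) = (\<Sum>k\<in>{0..<int N}. ec (- (of_int n * of_int k / of_nat N)) * cnj (f k))" for n
    by (simp add: F_def cnj_ec mult.commute)
  have "complex_of_real (\<Sum>n\<in>{0..<int N}. (cmod (F n))^2) = (\<Sum>n\<in>{0..<int N}. F n * cnj (F n))"
    by (simp only: of_real_sum complex_norm_square)
  also have "\<dots> = (\<Sum>n\<in>{0..<int N}. \<Sum>k\<in>{0..<int N}. cnj (f k) * (ec (- (of_int n * of_int k / of_nat N)) * F n))"
    by (simp add: cF sum_distrib_left mult_ac)
  also have "\<dots> = (\<Sum>k\<in>{0..<int N}. cnj (f k) * (\<Sum>n\<in>{0..<int N}. ec (- (of_int n * of_int k / of_nat N)) * F n))"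
    by (subst sum.swap) (simp add: sum_distrib_left)
  also have "\<dots> = (\<Sum>k\<in>{0..<int N}. cnj (f k) * (of_nat N * f k))"
    unfolding F_def using dft_inversion[OF assms] by simp
  also have "\<dots> = complex_of_real (of_nat N * (\<Sum>k\<in>{0..<int N}. (cmod (f k))^2))"
    unfolding of_real_mult of_real_sum complex_norm_square sum_distrib_left
    by (simp add: mult_ac)
  finally show ?thesis
    unfolding F_def of_real_eq_iff .
qed

subsection \<open>The Zak transform and Gabor bases\<close>

text \<open>For fixed \<open>m\<close> this is the discrete Fourier transform of the samples of
  \<open>b\<close> on the residue class of \<open>m\<close> modulo \<open>N\<close>.\<close>

definition zak :: "nat \<Rightarrow> (int \<Rightarrow> complex) \<Rightarrow> int \<Rightarrow> int \<Rightarrow> complex" where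
  "zak N b m n = (\<Sum>k\<in>{0..<int N}. ec (of_int k * of_int n / of_nat N) * b (m - int N * k))"

lemma ell2_periodic: "b \<in> ell2 N \<Longrightarrow> b (j + int (N^2)) = b j"
  by (simp add: ell2_def)

lemma ell2_diff_mult:
  assumes "b \<in> ell2 N"
  shows "b (j - int N * (q + int N)) = b (j - int N * q)"
  using ell2_periodic[OF assms, of "j - int N * (q + int N)"]
  by (simp add: algebra_simps power2_eq_square)

lemma ec_periodic_div:
  assumes "N > 0"
  shows "ec (of_int (k + int N) * of_int n / of_nat N) = ec (of_int k * of_int n / of_nat N)"
proof -
  have "(of_int (k + int N) * of_int n / of_nat N :: real) = of_int k * of_int n / of_nat N + of_int n"
    using assms by (simp add: field_simps)
  then show ?thesis by (simp add: ec_add)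
qed

lemma ec_periodic_div':
  assumes "N > 0"
  shows "ec (of_int k * of_int (n + int N) / of_nat N) = ec (of_int k * of_int n / of_nat N)"
  using ec_periodic_div[OF assms, of n k] by (simp add: mult.commute)

lemma zak_periodic: "N > 0 \<Longrightarrow> zak N b m (n + int N) = zak N b m n"
  unfolding zak_def by (simp only: ec_periodic_div')

lemma zak_quasi_periodic:
  assumes "N > 0" "b \<in> ell2 N"
  shows "zak N b (m + int N) n = ec (of_int n / of_nat N) * zak N b m n"
proof -
  let ?g = "\<lambda>k. ec (of_int k * of_int n / of_nat N) * b (m + int N - int N * k)"
  have "zak N b (m + int N) n = (\<Sum>k\<in>{0..<int N}. ?g (k + 1))"
    unfolding zak_def
  proof (rule sum_periodic_shift[symmetric])
    fix k
    show "?g (k + int N) = ?g k"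
      using assms ec_periodic_div[of N] ell2_diff_mult[of b N] by simp
  qed (use assms in auto)
  also have "\<dots> = ec (of_int n / of_nat N) * zak N b m n"
    by (simp add: zak_def sum_distrib_left ec_add ring_distribs add_divide_distrib mult_ac)
  finally show ?thesis .
qed

lemma norm_zak_periodic:
  assumes "N > 0" "b \<in> ell2 N"
  shows "cmod (zak N b (m + int N) n) = cmod (zak N b m n)"
  using zak_quasi_periodic[OF assms] by (simp add: norm_mult)

lemma zak_parseval:
  assumes "N > 0" "b \<in> ell2 N"
  shows "(\<Sum>m\<in>{0..<int N}. \<Sum>n\<in>{0..<int N}. (cmod (zak N b m n))^2)
    = of_nat N * (\<Sum>j\<in>{0..<int (N^2)}. (cmod (b j))^2)"
  unfolding zak_def dft_parseval[OF assms(1)]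
  using assms by (subst sum_residues_split) (auto simp: sum_distrib_left ell2_periodic simp del: of_nat_power)

section \<open>The Fourier transform on the side of the Zak transform\<close>

lemma fourier_d_ec:
  "fourier_d N b k = (1 / of_nat N) * (\<Sum>j\<in>{0..<int (N^2)}. b j * ec (- (of_int j * of_int k / of_nat (N^2))))"
proof -
  have "exp (- (2 * of_real pi * \<i> * of_int j * of_int k / of_nat (N^2)))
      = ec (- (of_int j * of_int k / of_nat (N^2)))" for j
    using exp_eq_ec[of j "-k" "N^2"] by simp
  then show ?thesis by (simp add: fourier_d_def)
qed

lemma ec_kernel_periodic:
  assumes "N > 0"
  shows "ec (- (of_int (j + int (N^2)) * of_int k / of_nat (N^2))) = ec (- (of_int j * of_int k / of_nat (N^2)))"
  using ec_periodic_div[of "N^2" j "-k"] assms by simp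

lemma fourier_d_ell2:
  assumes "N > 0"
  shows "fourier_d N b \<in> ell2 N"
proof -
  have "ec (- (of_int j * of_int (k + int (N^2)) / of_nat (N^2))) = ec (- (of_int j * of_int k / of_nat (N^2)))" for j k
    using ec_periodic_div[of "N^2" k "-j"] assms by (simp add: mult.commute)
  then show ?thesis
    unfolding ell2_def fourier_d_ec mem_Collect_eq by (simp only:) simp
qed

text \<open>The sum over \<open>k\<close> is a character sum that selects the \<open>j\<close>
  congruent to \<open>- n\<close> modulo \<open>N\<close>. On \<open>j = - n - N q\<close> the
  Fourier kernel splits into the phase in front and the character of the Zak transform at
  \<open>(- n, m)\<close>.\<close>

lemma zak_fourier:
  assumes "N > 0" "b \<in> ell2 N"
  shows "zak N (fourier_d N b) m n = ec (of_int m * of_int n / of_nat (N^2)) * zak N b (- n) m"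
proof -
  have *: "ec (of_int k * of_int n / of_nat N) * ec (- (of_int j * of_int (m - int N * k) / of_nat (N^2)))
     = ec (- (of_int j * of_int m / of_nat (N^2))) * ec (of_int k * of_int (n + j) / of_nat N)" for k j
  proof -
    have "of_int k * of_int n / of_nat N + - (of_int j * of_int (m - int N * k) / of_nat (N^2))
      = - (of_int j * of_int m / of_nat (N^2)) + of_int k * of_int (n + j) / (of_nat N :: real)"
      using assms(1) by (simp add: field_simps power2_eq_square)
    then show ?thesis
      by (simp only: ec_add[symmetric])
  qed
  let ?h = "\<lambda>j. b j * ec (- (of_int j * of_int m / of_nat (N^2))) * (if int N dvd n + j then 1 else 0)"
  have dv: "int N dvd n + (j + int (N^2)) \<longleftrightarrow> int N dvd n + j" for j
    by (metis add.assoc dvd_add_left_iff dvd_triv_left of_nat_mult power2_eq_square)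
  have per: "?h (j + int (N^2)) = ?h j" for j
    unfolding ell2_periodic[OF assms(2)] ec_kernel_periodic[OF assms(1)] dv ..
  have "zak N (fourier_d N b) m n = (1 / of_nat N) * (\<Sum>k\<in>{0..<int N}. \<Sum>j\<in>{0..<int (N^2)}.
      b j * (ec (of_int k * of_int n / of_nat N) * ec (- (of_int j * of_int (m - int N * k) / of_nat (N^2)))))"
    unfolding zak_def fourier_d_ec by (simp add: sum_distrib_left mult_ac)
  also have "\<dots> = (1 / of_nat N) * (\<Sum>j\<in>{0..<int (N^2)}.
      b j * ec (- (of_int j * of_int m / of_nat (N^2))) * (\<Sum>k\<in>{0..<int N}. ec (of_int k * of_int (n + j) / of_nat N)))"
    unfolding * by (subst sum.swap) (simp add: sum_distrib_left mult_ac)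
  also have "\<dots> = (\<Sum>j\<in>{0..<int (N^2)}. ?h j)"
    unfolding sum_ec[OF assms(1)] sum_distrib_left
    using assms(1) by (intro sum.cong) auto
  \<comment> \<open>Moving the origin to \<open>- n\<close> makes \<open>r = 0\<close> the residue
    class that survives.\<close>
  also have "\<dots> = (\<Sum>j\<in>{0..<int (N^2)}. ?h (j + (- n)))"
    by (rule sum_periodic_shift[symmetric]) (use assms per in auto)
  also have "\<dots> = (\<Sum>r\<in>{0..<int N}. \<Sum>q\<in>{0..<int N}. ?h (r - int N * q + (- n)))"
  proof (rule sum_residues_split)
    fix j
    have *: "j + int (N^2) + (- n) = j + (- n) + int (N^2)" by simp
    show "?h (j + int (N^2) + (- n)) = ?h (j + (- n))"
      unfolding * by (rule per)
  qed (use assms in auto)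
  also have "\<dots> = (\<Sum>r\<in>{0..<int N}. if r = 0 then (\<Sum>q\<in>{0..<int N}. ?h (- int N * q + (- n))) else 0)"
  proof (intro sum.cong refl)
    fix r assume r: "r \<in> {0..<int N}"
    have "int N dvd n + (r - int N * q + (- n)) \<longleftrightarrow> r = 0" for q
    proof -
      have "int N dvd n + (r - int N * q + (- n)) \<longleftrightarrow> int N dvd r"
        by (metis add.commute diff_add_cancel diff_minus_eq_add dvd_add_left_iff dvd_triv_left minus_diff_eq uminus_add_conv_diff)
      then show ?thesis
        using dvd_diff_residues_iff[OF r, of 0] assms by simp
    qed
    then show "(\<Sum>q\<in>{0..<int N}. ?h (r - int N * q + (- n)))
       = (if r = 0 then (\<Sum>q\<in>{0..<int N}. ?h (- int N * q + (- n))) else 0)"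
      by (auto intro!: sum.cong)
  qed
  also have "\<dots> = (\<Sum>q\<in>{0..<int N}. ?h (- int N * q + (- n)))"
    using assms by (subst sum.delta) auto
  also have "\<dots> = (\<Sum>q\<in>{0..<int N}. ec (of_int m * of_int n / of_nat (N^2)) *
      (ec (of_int q * of_int m / of_nat N) * b (- n - int N * q)))"
  proof (intro sum.cong refl)
    fix q
    have "- (of_int (- int N * q + (- n)) * of_int m / of_nat (N^2))
       = of_int m * of_int n / of_nat (N^2) + of_int q * of_int m / (of_nat N :: real)"
      using assms(1) by (simp add: field_simps power2_eq_square)
    moreover have "int N dvd n + (- int N * q + (- n))" by simp
    moreover have "- int N * q + (- n) = - n - int N * q" by simp
    ultimately show "?h (- int N * q + (- n)) = ec (of_int m * of_int n / of_nat (N^2)) *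
      (ec (of_int q * of_int m / of_nat N) * b (- n - int N * q))"
      by (simp only: ec_add) (simp add: mult_ac)
  qed
  also have "\<dots> = ec (of_int m * of_int n / of_nat (N^2)) * zak N b (- n) m"
    by (simp add: zak_def sum_distrib_left)
  finally show ?thesis .
qed

text \<open>The autocorrelation of the samples on one residue class. Both the squared modulus of the
  Zak transform and the Gabor inner products are Fourier sums of it.\<close>

definition zak_autocorr :: "nat \<Rightarrow> (int \<Rightarrow> complex) \<Rightarrow> int \<Rightarrow> int \<Rightarrow> complex" where
  "zak_autocorr N b m k = (\<Sum>q\<in>{0..<int N}. b (m - int N * q - int N * k) * cnj (b (m - int N * q)))"

lemma zak_autocorr_shift:
  assumes "N > 0" "b \<in> ell2 N"
  shows "(\<Sum>q\<in>{0..<int N}. b (m - int N * (q + a) - int N * k) * cnj (b (m - int N * (q + a))))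
    = zak_autocorr N b m k"
  unfolding zak_autocorr_def
proof (rule sum_periodic_shift)
  fix q
  have A: "b (m - int N * (q + int N) - int N * k) = b (m - int N * q - int N * k)"
    using ell2_diff_mult[OF assms(2), of "m - int N * k" q] by (simp add: algebra_simps)
  show "b (m - int N * (q + int N) - int N * k) * cnj (b (m - int N * (q + int N)))
    = b (m - int N * q - int N * k) * cnj (b (m - int N * q))"
    unfolding A ell2_diff_mult[OF assms(2), of m q] ..
qed (use assms in auto)

text \<open>The squared modulus of a discrete Fourier transform is the transform of the
  autocorrelation.\<close>

lemma zak_norm_square:
  assumes "N > 0" "b \<in> ell2 N"
  shows "complex_of_real ((cmod (zak N b m n))^2)
    = (\<Sum>k\<in>{0..<int N}. ec (of_int k * of_int n / of_nat N) * zak_autocorr N b m k)"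
proof -
  let ?t = "\<lambda>k q. ec (of_int (k - q) * of_int n / of_nat N) * (b (m - int N * k) * cnj (b (m - int N * q)))"
  have "complex_of_real ((cmod (zak N b m n))^2) = zak N b m n * cnj (zak N b m n)"
    by (rule complex_norm_square)
  also have "\<dots> = (\<Sum>q\<in>{0..<int N}. \<Sum>k\<in>{0..<int N}. ?t k q)"
    unfolding zak_def cnj_sum sum_distrib_left sum_distrib_right
    by (simp add: cnj_ec diff_divide_distrib ring_distribs ec_add[of _ "- _", simplified] mult_ac)
  \<comment> \<open>For each \<open>q\<close> the index \<open>k\<close> becomes
    \<open>k + q\<close>, so that the character depends on the lag alone.\<close>
  also have "\<dots> = (\<Sum>q\<in>{0..<int N}. \<Sum>k\<in>{0..<int N}. ?t (k + q) q)"
  proof (rule sum.cong[OF refl])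
    fix q
    have "ec (of_int (k + int N - q) * of_int n / of_nat N) = ec (of_int (k - q) * of_int n / of_nat N)" for k
      using ec_periodic_div[OF assms(1), of "k - q" n] by (simp add: algebra_simps)
    then have "?t (k + int N) q = ?t k q" for k
      by (simp only: ell2_diff_mult[OF assms(2)])
    then show "(\<Sum>k\<in>{0..<int N}. ?t k q) = (\<Sum>k\<in>{0..<int N}. ?t (k + q) q)"
      using assms(1) by (intro sum_periodic_shift[symmetric]) auto
  qed
  also have "\<dots> = (\<Sum>k\<in>{0..<int N}. ec (of_int k * of_int n / of_nat N) * zak_autocorr N b m k)"
    unfolding zak_autocorr_def sum_distrib_left
    by (subst sum.swap) (simp add: algebra_simps)
  finally show ?thesis .
qed

text \<open>The constant function 1 of \<open>n\<close> is the transform of the unit mass at lag 0,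
  and the transform is injective.\<close>

lemma zak_unimodular_iff:
  assumes "N > 0" "b \<in> ell2 N"
  shows "(\<forall>n. cmod (zak N b m n) = 1)
    \<longleftrightarrow> (\<forall>k\<in>{0..<int N}. zak_autocorr N b m k = (if k = 0 then 1 else 0))"
proof
  assume 1: "\<forall>n. cmod (zak N b m n) = 1"
  show "\<forall>k\<in>{0..<int N}. zak_autocorr N b m k = (if k = 0 then 1 else 0)"
  proof
    fix k assume k: "k \<in> {0..<int N}"
    have "(\<Sum>k'\<in>{0..<int N}. ec (of_int k' * of_int n / of_nat N) * zak_autocorr N b m k') = 1" for n
      using zak_norm_square[OF assms, of m n] 1 by simp
    then have "of_nat N * zak_autocorr N b m k
        = (\<Sum>n\<in>{0..<int N}. ec (- (of_int n * of_int k / of_nat N)))"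
      using dft_inversion[OF assms(1) k, of "zak_autocorr N b m"] by simp
    also have "\<dots> = (if int N dvd - k then of_nat N else 0)"
      using sum_ec[OF assms(1), of "- k"] by simp
    also have "\<dots> = of_nat N * (if k = 0 then 1 else 0)"
      using dvd_diff_residues_iff[OF k, of 0] assms(1) by simp
    finally show "zak_autocorr N b m k = (if k = 0 then 1 else 0)"
      using assms(1) by simp
  qed
next
  assume R: "\<forall>k\<in>{0..<int N}. zak_autocorr N b m k = (if k = 0 then 1 else 0)"
  show "\<forall>n. cmod (zak N b m n) = 1"
  proof
    fix n
    have "complex_of_real ((cmod (zak N b m n))^2)
        = (\<Sum>k\<in>{0..<int N}. if k = 0 then ec (of_int k * of_int n / of_nat N) else 0)"
      unfolding zak_norm_square[OF assms] using R by (intro sum.cong) auto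
    also have "\<dots> = complex_of_real 1"
      using assms(1) by (subst sum.delta) auto
    finally have "(cmod (zak N b m n))^2 = 1"
      unfolding of_real_eq_iff .
    then show "cmod (zak N b m n) = 1"
      by (simp add: power2_eq_1_iff) (metis norm_ge_zero not_one_le_zero neg_0_le_iff_le)
  qed
qed

lemma zak_autocorr_periodic:
  assumes "b \<in> ell2 N"
  shows "zak_autocorr N b m (k + int N) = zak_autocorr N b m k"
  unfolding zak_autocorr_def
  unfolding ell2_diff_mult[OF assms] ..

section \<open>Inner products and completeness of the Gabor system\<close>

lemma NZ_eq:
  assumes "N > 0"
  shows "NZ N = (\<lambda>k. int N * k) ` {0..<int N}"
proof -
  have "(int N * k) mod int (N^2) = int N * (k mod int N)" for k
    by (simp add: power2_eq_square)
  then show ?thesis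
    using assms unfolding NZ_def
    by (auto simp: image_iff) (metis mod_pos_pos_trivial)
qed

lemma gabor_ec:
  assumes "N > 0"
  shows "gabor N b (int N * k, int N * l) j = ec (of_int l * of_int j / of_nat N) * b (j - int N * k)"
proof -
  have "of_int (int N * l) * of_int j / of_nat (N^2) = (of_int l * of_int j / of_nat N :: real)"
    using assms by (simp add: power2_eq_square)
  then show ?thesis
    unfolding gabor_def by (simp only: prod.case exp_eq_ec)
qed

lemma gabor_ell2:
  assumes "N > 0" "b \<in> ell2 N"
  shows "gabor N b (int N * k, int N * l) \<in> ell2 N"
proof -
  have "ec (of_int l * of_int (j + int (N^2)) / of_nat N) = ec (of_int l * of_int j / of_nat N)" for j
  proof -
    have "of_int l * of_int (j + int (N^2)) / of_nat N = of_int l * of_int j / of_nat N + (of_int (l * int N) :: real)"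
      using assms(1) by (simp add: field_simps power2_eq_square)
    then show ?thesis by (simp only: ec_add_int)
  qed
  moreover have "b (j + int (N^2) - int N * k) = b (j - int N * k)" for j
    using ell2_periodic[OF assms(2), of "j - int N * k"] by (simp add: algebra_simps)
  ultimately show ?thesis
    unfolding ell2_def mem_Collect_eq by (simp only: gabor_ec[OF assms(1)]) simp
qed

text \<open>The product of two modulations with frequencies in \<open>N Z\<close> is constant along
  \<open>m - N q\<close>, so the sum over \<open>q\<close> is an autocorrelation at the difference
  of the translations.\<close>

lemma inner_gabor:
  assumes "N > 0" "b \<in> ell2 N"
  shows "inner_d N (gabor N b (int N * k, int N * l)) (gabor N b (int N * k', int N * l'))
    = (1 / of_nat N) * (\<Sum>m\<in>{0..<int N}. ec (of_int m * of_int (l - l') / of_nat N) * zak_autocorr N b m (k - k'))"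
proof -
  have *: "ec (of_int l * of_int (m - int N * q) / of_nat N) * cnj (ec (of_int l' * of_int (m - int N * q) / of_nat N))
     = ec (of_int m * of_int (l - l') / of_nat N)" for m q
  proof -
    have "of_int l * of_int (m - int N * q) / of_nat N + - (of_int l' * of_int (m - int N * q) / of_nat N)
      = of_int m * of_int (l - l') / of_nat N + (of_int (- (l - l') * q) :: real)"
      using assms(1) by (simp add: field_simps)
    then show ?thesis
      by (simp only: cnj_ec ec_add[symmetric] ec_add_int)
  qed
  have "inner_d N (gabor N b (int N * k, int N * l)) (gabor N b (int N * k', int N * l'))
    = (1 / of_nat N) * (\<Sum>m\<in>{0..<int N}. \<Sum>q\<in>{0..<int N}.
        gabor N b (int N * k, int N * l) (m - int N * q) * cnj (gabor N b (int N * k', int N * l') (m - int N * q)))"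
    unfolding inner_d_def
    using gabor_ell2[OF assms] assms(1) by (subst sum_residues_split) (simp_all add: ell2_def)
  also have "\<dots> = (1 / of_nat N) * (\<Sum>m\<in>{0..<int N}. ec (of_int m * of_int (l - l') / of_nat N) *
      (\<Sum>q\<in>{0..<int N}. b (m - int N * (q + k') - int N * (k - k')) * cnj (b (m - int N * (q + k')))))"
  proof -
    have "gabor N b (int N * k, int N * l) (m - int N * q) * cnj (gabor N b (int N * k', int N * l') (m - int N * q))
      = ec (of_int m * of_int (l - l') / of_nat N) *
        (b (m - int N * (q + k') - int N * (k - k')) * cnj (b (m - int N * (q + k'))))" for m q
      unfolding gabor_ec[OF assms(1)] *[symmetric, of m q] by (simp add: algebra_simps)
    then show ?thesis by (simp add: sum_distrib_left)
  qed
  finally show ?thesis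
    by (simp only: zak_autocorr_shift[OF assms])
qed

lemma zak_autocorr_conj:
  assumes "N > 0" "b \<in> ell2 N"
  shows "(\<Sum>k\<in>{0..<int N}. b (m - int N * k) * cnj (b (m - int N * k - int N * q))) = cnj (zak_autocorr N b m q)"
  by (simp add: zak_autocorr_def mult.commute)

text \<open>Completeness comes from an explicit expansion: the sum over \<open>l\<close> keeps only
  the samples of \<open>a\<close> on the residue class of \<open>j\<close>, and the sum over
  \<open>k\<close> is then the conjugate autocorrelation at lag \<open>q\<close>, a unit mass by
  \<open>R\<close>.\<close>

lemma gabor_expansion:
  assumes "N > 0" "b \<in> ell2 N" "a \<in> ell2 N"
    and R: "\<And>m k. k \<in> {0..<int N} \<Longrightarrow> zak_autocorr N b m k = (if k = 0 then 1 else 0)"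
  shows "a j = (\<Sum>x\<in>NZ N \<times> NZ N. inner_d N a (gabor N b x) * gabor N b x j)"
proof -
  let ?I = "{0..<int N}"
  have inj: "inj_on (\<lambda>(k, l). (int N * k, int N * l)) (?I \<times> ?I)"
    using assms(1) by (auto simp: inj_on_def)
  have img: "NZ N \<times> NZ N = (\<lambda>(k, l). (int N * k, int N * l)) ` (?I \<times> ?I)"
    using NZ_eq[OF assms(1)] by auto
  have inner: "inner_d N a (gabor N b (int N * k, int N * l)) * gabor N b (int N * k, int N * l) j
    = (1 / of_nat N) * (\<Sum>m\<in>?I. \<Sum>q\<in>?I. ec (of_int l * of_int (- m) / of_nat N) *
       (a (j + m - int N * q) * (b (j - int N * k) * cnj (b (j + m - int N * q - int N * k)))))" for k l
  proof -
    let ?h = "\<lambda>i. a i * cnj (gabor N b (int N * k, int N * l) i)"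
    have per: "?h (i + int (N^2)) = ?h i" for i
      using ell2_periodic[OF gabor_ell2[OF assms(1,2)]] ell2_periodic[OF assms(3)] by simp
    have "inner_d N a (gabor N b (int N * k, int N * l)) = (1 / of_nat N) * (\<Sum>i\<in>{0..<int (N^2)}. ?h i)"
      by (simp add: inner_d_def)
    \<comment> \<open>With the origin at \<open>j\<close>, the residue class kept by the sum over
      \<open>l\<close> is \<open>m = 0\<close>.\<close>
    also have "(\<Sum>i\<in>{0..<int (N^2)}. ?h i) = (\<Sum>i\<in>{0..<int (N^2)}. ?h (i + j))"
      by (rule sum_periodic_shift[symmetric]) (use assms per in auto)
    also have "\<dots> = (\<Sum>m\<in>?I. \<Sum>q\<in>?I. ?h (m - int N * q + j))"
    proof (rule sum_residues_split)
      fix i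
      have *: "i + int (N^2) + j = (i + j) + int (N^2)" by simp
      show "?h (i + int (N^2) + j) = ?h (i + j)"
        unfolding * by (rule per)
    qed (use assms in auto)
    finally have 1: "inner_d N a (gabor N b (int N * k, int N * l))
      = (1 / of_nat N) * (\<Sum>m\<in>?I. \<Sum>q\<in>?I. ?h (m - int N * q + j))" .
    have 2: "?h (m - int N * q + j) * gabor N b (int N * k, int N * l) j
      = ec (of_int l * of_int (- m) / of_nat N) *
       (a (j + m - int N * q) * (b (j - int N * k) * cnj (b (j + m - int N * q - int N * k))))" for m q
    proof -
      have "- (of_int l * of_int (j + m - int N * q) / of_nat N) + of_int l * of_int j / of_nat N
        = of_int l * of_int (- m) / of_nat N + (of_int (l * q) :: real)"
        using assms(1) by (simp add: field_simps)
      then have E: "cnj (ec (of_int l * of_int (j + m - int N * q) / of_nat N)) * ec (of_int l * of_int j / of_nat N)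
        = ec (of_int l * of_int (- m) / of_nat N)"
        by (simp only: cnj_ec ec_add[symmetric] ec_add_int)
      have X: "m - int N * q + j = j + m - int N * q" by simp
      show ?thesis
        unfolding gabor_ec[OF assms(1)] X E[symmetric] complex_cnj_mult by (simp only: mult_ac)
    qed
    show ?thesis
      unfolding 1 2[symmetric] by (simp add: sum_distrib_right mult.assoc)
  qed
  have "(\<Sum>x\<in>NZ N \<times> NZ N. inner_d N a (gabor N b x) * gabor N b x j)
    = (\<Sum>k\<in>?I. \<Sum>l\<in>?I. inner_d N a (gabor N b (int N * k, int N * l)) * gabor N b (int N * k, int N * l) j)"
    unfolding img sum.reindex[OF inj] sum.cartesian_product by (simp add: case_prod_beta)
  also have "\<dots> = (1 / of_nat N) * (\<Sum>k\<in>?I. \<Sum>l\<in>?I. \<Sum>m\<in>?I. \<Sum>q\<in>?I. ec (of_int l * of_int (- m) / of_nat N) *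
       (a (j + m - int N * q) * (b (j - int N * k) * cnj (b (j + m - int N * q - int N * k)))))"
    unfolding inner sum_distrib_left ..
  also have "\<dots> = (1 / of_nat N) * (\<Sum>k\<in>?I. \<Sum>m\<in>?I. (\<Sum>l\<in>?I. ec (of_int l * of_int (- m) / of_nat N)) *
       (\<Sum>q\<in>?I. a (j + m - int N * q) * (b (j - int N * k) * cnj (b (j + m - int N * q - int N * k)))))"
    by (subst (2) sum.swap) (simp add: sum_product)
  also have "\<dots> = (1 / of_nat N) * (\<Sum>k\<in>?I. \<Sum>m\<in>?I. if m = 0 then of_nat N *
       (\<Sum>q\<in>?I. a (j - int N * q) * (b (j - int N * k) * cnj (b (j - int N * q - int N * k)))) else 0)"
  proof -
    have "int N dvd - m \<longleftrightarrow> m = 0" if "m \<in> ?I" for m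
      using dvd_diff_residues_iff[OF that, of 0] assms(1) by simp
    then show ?thesis
      unfolding sum_ec[OF assms(1)]
      by (intro arg_cong2[where f = "(*)"] refl sum.cong) auto
  qed
  also have "\<dots> = (1 / of_nat N) * (\<Sum>k\<in>?I. of_nat N *
       (\<Sum>q\<in>?I. a (j - int N * q) * (b (j - int N * k) * cnj (b (j - int N * q - int N * k)))))"
    using assms(1) by (subst sum.delta) auto
  also have "\<dots> = (\<Sum>k\<in>?I. \<Sum>q\<in>?I. a (j - int N * q) * (b (j - int N * k) * cnj (b (j - int N * k - int N * q))))"
    using assms(1) by (simp add: sum_distrib_left[symmetric] algebra_simps)
  also have "\<dots> = (\<Sum>q\<in>?I. a (j - int N * q) * cnj (zak_autocorr N b j q))"
    by (subst sum.swap) (simp add: sum_distrib_left[symmetric] zak_autocorr_conj[OF assms(1,2)])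
  also have "\<dots> = (\<Sum>q\<in>?I. if q = 0 then a j else 0)"
    using R by (intro sum.cong) auto
  also have "\<dots> = a j"
    using assms(1) by (subst sum.delta) auto
  finally show ?thesis ..
qed

text \<open>The inner products with \<open>b\<close> itself are Fourier sums in \<open>m\<close> of
  the autocorrelation, which Fourier inversion recovers. Conversely, a unit mass as autocorrelation
  yields both orthonormality and the expansion.\<close>

lemma gabor_basis_iff:
  assumes "N > 0" "b \<in> ell2 N"
  shows "orthonormal_basis_d N (NZ N \<times> NZ N) (gabor N b) \<longleftrightarrow> (\<forall>m n. cmod (zak N b m n) = 1)"
proof
  let ?I = "{0..<int N}"
  assume onb: "orthonormal_basis_d N (NZ N \<times> NZ N) (gabor N b)"
  have R: "zak_autocorr N b m k = (if k = 0 then 1 else 0)" if k: "k \<in> ?I" and m: "m \<in> ?I" for m k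
  proof -
    have "(\<Sum>m'\<in>?I. ec (of_int m' * of_int l / of_nat N) * zak_autocorr N b m' k)
      = (if k = 0 \<and> l = 0 then of_nat N else 0)" if l: "l \<in> ?I" for l
    proof -
      have "(int N * k, int N * l) \<in> NZ N \<times> NZ N" "(int N * 0, int N * 0) \<in> NZ N \<times> NZ N"
        using k l assms(1) by (auto simp: NZ_eq[OF assms(1)])
      then have "inner_d N (gabor N b (int N * k, int N * l)) (gabor N b (int N * 0, int N * 0))
        = (if (int N * k, int N * l) = (int N * 0, int N * 0) then 1 else 0)"
        using onb unfolding orthonormal_basis_d_def by blast
      then show ?thesis
        unfolding inner_gabor[OF assms] using assms(1) by (auto split: if_splits)
    qed
    then have "of_nat N * zak_autocorr N b m k
      = (\<Sum>l\<in>?I. ec (- (of_int l * of_int m / of_nat N)) * (if k = 0 \<and> l = 0 then of_nat N else 0))"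
      using dft_inversion[OF assms(1) m, of "\<lambda>m. zak_autocorr N b m k"] by simp
    also have "\<dots> = (\<Sum>l\<in>?I. if l = 0 then of_nat N * (if k = 0 then 1 else 0) else 0)"
      by (intro sum.cong) auto
    also have "\<dots> = of_nat N * (if k = 0 then 1 else 0)"
      using assms(1) by (subst sum.delta) auto
    finally show ?thesis using assms(1) by simp
  qed
  show "\<forall>m n. cmod (zak N b m n) = 1"
  proof (intro allI)
    fix m n
    have "cmod (zak N b (m mod int N) n) = 1"
      using zak_unimodular_iff[OF assms, of "m mod int N"] R assms(1) by simp
    moreover have "cmod (zak N b (m mod int N) n) = cmod (zak N b m n)"
      by (rule periodic_mod[of "\<lambda>m. cmod (zak N b m n)"]) (rule norm_zak_periodic[OF assms])
    ultimately show "cmod (zak N b m n) = 1" by simp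
  qed
next
  let ?I = "{0..<int N}"
  assume "\<forall>m n. cmod (zak N b m n) = 1"
  then have R: "zak_autocorr N b m k = (if k = 0 then 1 else 0)" if "k \<in> ?I" for m k
    using zak_unimodular_iff[OF assms] that by blast
  \<comment> \<open>A difference of translations may be negative and is first reduced modulo
    \<open>N\<close>.\<close>
  have R': "zak_autocorr N b m (k - k') = (if k = k' then 1 else 0)" if "k \<in> ?I" "k' \<in> ?I" for m k k'
  proof -
    have "zak_autocorr N b m (k - k') = zak_autocorr N b m ((k - k') mod int N)"
      by (rule periodic_mod[symmetric]) (rule zak_autocorr_periodic[OF assms(2)])
    then show ?thesis
      using R[of "(k - k') mod int N"] assms(1) dvd_diff_residues_iff[OF that]
      by (simp add: dvd_eq_mod_eq_0)
  qed
  have "inner_d N (gabor N b x) (gabor N b y) = (if x = y then 1 else 0)"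
    if xy: "x \<in> NZ N \<times> NZ N" "y \<in> NZ N \<times> NZ N" for x y
  proof -
    from xy obtain k l k' l' where
      x: "x = (int N * k, int N * l)" "k \<in> ?I" "l \<in> ?I" and
      y: "y = (int N * k', int N * l')" "k' \<in> ?I" "l' \<in> ?I"
      unfolding NZ_eq[OF assms(1)] by blast
    have "inner_d N (gabor N b x) (gabor N b y)
      = (1 / of_nat N) * ((if k = k' then 1 else 0) * (\<Sum>m\<in>?I. ec (of_int m * of_int (l - l') / of_nat N)))"
      unfolding x(1) y(1) inner_gabor[OF assms] R'[OF x(2) y(2)] by (simp add: sum_distrib_left mult.commute)
    also have "\<dots> = (if x = y then 1 else 0)"
      unfolding sum_ec[OF assms(1)] dvd_diff_residues_iff[OF x(3) y(3)]
      using assms(1) by (auto simp: x y)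
    finally show ?thesis .
  qed
  moreover have "gabor N b x \<in> ell2 N" if "x \<in> NZ N \<times> NZ N" for x
    using that gabor_ell2[OF assms] unfolding NZ_eq[OF assms(1)] by auto
  moreover have "\<exists>c. \<forall>j. a j = (\<Sum>x\<in>NZ N \<times> NZ N. c x * gabor N b x j)" if "a \<in> ell2 N" for a
  proof -
    have "a j = (\<Sum>x\<in>NZ N \<times> NZ N. inner_d N a (gabor N b x) * gabor N b x j)" for j
      by (rule gabor_expansion[OF assms that R])
    then show ?thesis
      by (intro exI[of _ "\<lambda>x. inner_d N a (gabor N b x)"] allI)
  qed
  ultimately show "orthonormal_basis_d N (NZ N \<times> NZ N) (gabor N b)"
    unfolding orthonormal_basis_d_def using NZ_eq[OF assms(1)] by simp
qed

subsection \<open>Jumps of quasi-periodic functions\<close>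

text \<open>Turns an identity modulo \<open>2 * pi\<close> into one between reals; the circulation
  argument rests on it.\<close>

lemma cis_eq_imp_eq:
  assumes "cis a = cis b" "\<bar>a - b\<bar> < 2 * pi"
  shows "a = b"
proof -
  have "cis (a - b) = 1"
    using assms(1) by (simp add: cis_divide[symmetric])
  then have "cos (a - b) = 1"
    by (metis cis.sel(1) one_complex.sel(1))
  then obtain n :: int where n: "a - b = of_int n * 2 * pi"
    by (auto simp: cos_one_2pi_int)
  then have "\<bar>of_int n :: real\<bar> < 1"
    using assms(2) by (simp add: abs_mult)
  then have "n = 0" by linarith
  then show ?thesis using n by simp
qed

lemma norm_diff_one_square:
  assumes "cmod z = 1"
  shows "(cmod (z - 1))^2 = 2 - 2 * Re z"
proof -
  have "(Re z)^2 + (Im z)^2 = 1"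
    using assms by (simp add: cmod_def)
  moreover have "(cmod (z - 1))^2 = (Re z - 1)^2 + (Im z)^2"
    by (simp add: cmod_power2)
  ultimately show ?thesis
    by (simp add: power2_diff)
qed

text \<open>The hypothesis says \<open>Re z > 3/4\<close>, which exceeds
  \<open>cos (pi / 4)\<close>. A quarter of \<open>pi\<close> keeps the four increments around a
  cell below \<open>pi\<close> in total.\<close>

lemma abs_Arg_less_quarter_pi:
  assumes z: "cmod z = 1" "(cmod (z - 1))^2 < 1/2"
  shows "\<bar>Arg z\<bar> < pi / 4"
proof (rule ccontr)
  assume neg: "\<not> ?thesis"
  have "z \<noteq> 0" using z(1) by auto
  then have "Re z = cos (Arg z)"
    by (metis cis.sel(1) cis_Arg sgn_eq z(1) div_by_1 of_real_1)
  also have "\<dots> = cos \<bar>Arg z\<bar>" by simp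
  also have "\<dots> \<le> cos (pi / 4)"
    using neg Arg_bounded[of z] by (intro cos_monotone_0_pi_le) auto
  also have "\<dots> < 3 / 4"
  proof -
    have "sqrt 2 < sqrt ((3/2)^2)" by (subst real_sqrt_less_iff) (simp add: power2_eq_square)
    then show ?thesis by (simp add: cos_45)
  qed
  finally show False
    using norm_diff_one_square[OF z(1)] z(2) by simp
qed

lemma abs_Arg_divide_less_quarter_pi:
  assumes "cmod z = 1" "cmod w = 1" "(cmod (z - w))^2 < 1/2"
  shows "\<bar>Arg (z / w)\<bar> < pi / 4"
proof (rule abs_Arg_less_quarter_pi)
  have "w \<noteq> 0" using assms(2) by auto
  then have "z / w - 1 = (z - w) / w" by (simp add: field_simps)
  then show "(cmod (z / w - 1))^2 < 1/2"
    using assms by (simp add: norm_divide)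
qed (use assms in \<open>simp add: norm_divide\<close>)

text \<open>On the unit circle a small second difference forces a small first difference, because a
  step away from a point cannot be cancelled by an opposite step.\<close>

lemma second_diff_unimodular:
  assumes "cmod x = 1" "cmod y = 1" "cmod z = 1"
    and sd: "(cmod (x - 2 * y + z))^2 < 1/16"
  shows "(cmod (x - y))^2 < 1/2"
proof -
  have y: "y \<noteq> 0" using assms(2) by auto
  define u v where "u = x / y" and "v = z / y"
  have uv: "cmod u = 1" "cmod v = 1"
    using assms by (auto simp: u_def v_def norm_divide)
  have "(cmod (x - y))^2 = (cmod (u - 1))^2"
  proof -
    have "u - 1 = (x - y) / y" using y by (simp add: u_def field_simps)
    then show ?thesis using assms(2) by (simp add: norm_divide)
  qed
  moreover have "cmod (u + v - 2) < 1/4"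
  proof -
    have "u + v - 2 = (x - 2 * y + z) / y" using y by (simp add: u_def v_def field_simps)
    then have "cmod (u + v - 2) = cmod (x - 2 * y + z)"
      using assms(2) by (simp add: norm_divide)
    moreover have "cmod (x - 2 * y + z) < 1/4"
      by (rule power_less_imp_less_base[of _ 2]) (use sd in \<open>simp_all add: power2_eq_square\<close>)
    ultimately show ?thesis by simp
  qed
  \<comment> \<open>Both squares are nonnegative and their sum is less than twice
    \<open>1/4\<close>, so neither reaches \<open>1/2\<close>.\<close>
  moreover have "(cmod (u - 1))^2 + (cmod (v - 1))^2 = - 2 * Re (u + v - 2)"
    using uv by (simp add: norm_diff_one_square)
  moreover have "- Re (u + v - 2) \<le> cmod (u + v - 2)"
    using abs_Re_le_cmod[of "u + v - 2"] by linarith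
  ultimately show ?thesis
    using zero_le_power2[of "cmod (v - 1)"] by linarith
qed

text \<open>The circulation of the phase increments around a cell agrees with the flux
  \<open>- 2 * pi * area / N\<^sup>2\<close> modulo \<open>2 * pi\<close>. If all increments were small, the two would be equal;
  but the circulations over a period cell add up to 0 and the fluxes to \<open>- 2 * pi\<close>.\<close>

lemma quasi_periodic_grid_jump:
  fixes X U :: "int \<Rightarrow> int \<Rightarrow> complex" and x y :: "nat \<Rightarrow> int"
  assumes N: "N > 0"
    and X_norm: "\<And>m n. cmod (X m n) = 1"
    and X_per: "\<And>m n. X m (n + int N) = X m n"
    and U_per: "\<And>m n. U (m + int N) n = U m n"
    and U: "\<And>m n. U m n = ec (- (of_int m * of_int n / of_nat (N^2))) * X m n"
    and x: "x M = x 0 + int N" "\<And>a. 0 < x (Suc a) - x a" "\<And>a. 3 * (x (Suc a) - x a) \<le> 2 * int N"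
    and y: "y M = y 0 + int N" "\<And>b. 0 < y (Suc b) - y b" "\<And>b. 3 * (y (Suc b) - y b) \<le> 2 * int N"
  shows "\<exists>a<M. \<exists>b<M. 1/2 \<le> (cmod (X (x (Suc a)) (y b) - X (x a) (y b)))^2
      \<or> 1/2 \<le> (cmod (U (x a) (y (Suc b)) - U (x a) (y b)))^2"
proof (rule ccontr)
  assume "\<not> ?thesis"
  then have small: "(cmod (X (x (Suc a)) (y b) - X (x a) (y b)))^2 < 1/2"
    "(cmod (U (x a) (y (Suc b)) - U (x a) (y b)))^2 < 1/2" if "a < M" "b < M" for a b
    using that by (auto simp: not_le)
  \<comment> \<open>Phase increments of \<open>X\<close> along the first direction and of
    \<open>U\<close> along the second. \<open>X\<close> is periodic in \<open>n\<close> and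
    \<open>U\<close> in \<open>m\<close>, so the increments on opposite sides of the period cell
    agree.\<close>
  define H where "H a b = Arg (X (x (Suc a)) (y b) / X (x a) (y b))" for a b
  define V where "V a b = Arg (U (x a) (y (Suc b)) / U (x a) (y b))" for a b
  define A where "A a b = 2 * pi * (of_int (x (Suc a) - x a) * of_int (y (Suc b) - y b) / of_nat (N^2))" for a b
  have U_norm: "cmod (U m n) = 1" for m n
    by (simp add: U norm_mult X_norm)
  have X_nz: "X m n \<noteq> 0" and U_nz: "U m n \<noteq> 0" for m n
    using X_norm[of m n] U_norm[of m n] by auto
  have cis_H: "cis (H a b) = X (x (Suc a)) (y b) / X (x a) (y b)" for a b
    unfolding H_def using X_nz X_norm by (subst cis_Arg) (auto simp: sgn_eq norm_divide)
  have cis_V: "cis (V a b) = U (x a) (y (Suc b)) / U (x a) (y b)" for a b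
    unfolding V_def using U_nz U_norm by (subst cis_Arg) (auto simp: sgn_eq norm_divide)
  have HM: "H a M = H a 0" for a
    by (simp add: H_def y(1) X_per)
  have VM: "V M b = V 0 b" for b
    by (simp add: V_def x(1) U_per)
  have "M > 0" using x(1) N by (cases M) auto
  \<comment> \<open>The row \<open>b = M\<close> lies outside the range of \<open>small\<close>;
    periodicity identifies it with row 0.\<close>
  have H_small: "\<bar>H a b\<bar> < pi / 4" if "a < M" "b \<le> M" for a b
  proof -
    have *: "\<bar>H a b\<bar> < pi / 4" if "b < M" for b
      unfolding H_def using X_norm small(1)[OF \<open>a < M\<close> that]
      by (intro abs_Arg_divide_less_quarter_pi) auto
    show ?thesis
      using *[of b] *[of 0] HM \<open>b \<le> M\<close> \<open>M > 0\<close> by (cases "b = M") auto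
  qed
  have V_small: "\<bar>V a b\<bar> < pi / 4" if "a \<le> M" "b < M" for a b
  proof -
    have *: "\<bar>V a b\<bar> < pi / 4" if "a < M" for a
      unfolding V_def using U_norm small(2)[OF that \<open>b < M\<close>]
      by (intro abs_Arg_divide_less_quarter_pi) auto
    show ?thesis
      using *[of a] *[of 0] VM \<open>a \<le> M\<close> \<open>M > 0\<close> by (cases "a = M") auto
  qed
  have circ: "H a b + V (Suc a) b - H a (Suc b) - V a b = - A a b" if ab: "a < M" "b < M" for a b
  proof (rule cis_eq_imp_eq)
    have "cis (H a b + V (Suc a) b - H a (Suc b) - V a b)
      = cis (H a b) * cis (V (Suc a) b) / cis (H a (Suc b)) / cis (V a b)"
      by (simp add: cis_divide cis_mult)
    also have "\<dots> = ec (- (of_int (x (Suc a)) * of_int (y (Suc b)) / of_nat (N^2)))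
        / ec (- (of_int (x (Suc a)) * of_int (y b) / of_nat (N^2)))
        / ec (- (of_int (x a) * of_int (y (Suc b)) / of_nat (N^2)))
        * ec (- (of_int (x a) * of_int (y b) / of_nat (N^2)))"
      unfolding cis_H cis_V U using X_nz by (simp add: field_simps)
    also have "\<dots> = cis (- A a b)"
      unfolding ec_def cis_divide cis_mult A_def
      by (rule arg_cong[of _ _ cis]) (simp add: diff_divide_distrib add_divide_distrib algebra_simps)
    finally show "cis (H a b + V (Suc a) b - H a (Suc b) - V a b) = cis (- A a b)" .
    let ?g = "of_int (x (Suc a) - x a) :: real" and ?k = "of_int (y (Suc b) - y b) :: real"
    have g: "0 < ?g" "3 * ?g \<le> 2 * of_nat N" and k: "0 < ?k" "3 * ?k \<le> 2 * of_nat N"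
      using x(2,3)[of a] y(2,3)[of b] by linarith+
    have "(3 * ?g) * (3 * ?k) \<le> (2 * of_nat N) * (2 * of_nat N)"
      using g k by (intro mult_mono[of "3 * ?g"]) auto
    then have r1: "?g * ?k / of_nat (N^2) \<le> 4 / 9"
      using N by (simp add: field_simps power2_eq_square)
    have r0: "0 \<le> ?g * ?k / of_nat (N^2)"
      by (rule divide_nonneg_nonneg[OF mult_nonneg_nonneg[OF less_imp_le[OF g(1)] less_imp_le[OF k(1)]]]) simp
    have "0 \<le> A a b"
      unfolding A_def by (rule mult_nonneg_nonneg[OF _ r0]) simp
    moreover have "A a b \<le> 2 * pi * (4 / 9)"
      unfolding A_def by (rule mult_left_mono[OF r1]) simp
    \<comment> \<open>The increments total less than \<open>pi\<close> and the flux is at most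
      \<open>8 * pi / 9\<close>, together less than \<open>2 * pi\<close>.\<close>
    ultimately show "\<bar>H a b + V (Suc a) b - H a (Suc b) - V a b - - A a b\<bar> < 2 * pi"
      using H_small[of a b] V_small[of "Suc a" b] H_small[of a "Suc b"] V_small[of a b] ab pi_gt_zero
      by linarith
  qed
  \<comment> \<open>Increments on edges shared by two cells cancel; what is left on the boundary
    vanishes by \<open>HM\<close> and \<open>VM\<close>.\<close>
  have "(\<Sum>a<M. \<Sum>b<M. H a b + V (Suc a) b - H a (Suc b) - V a b)
    = (\<Sum>a<M. \<Sum>b<M. V (Suc a) b - V a b) - (\<Sum>a<M. \<Sum>b<M. H a (Suc b) - H a b)"
    by (simp add: sum.distrib sum_subtractf)
  also have "(\<Sum>a<M. \<Sum>b<M. H a (Suc b) - H a b) = 0"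
    by (simp only: sum_lessThan_telescope HM) simp
  also have "(\<Sum>a<M. \<Sum>b<M. V (Suc a) b - V a b) = 0"
    using sum_lessThan_telescope[of "\<lambda>a. V a _" M] VM by (subst sum.swap) simp
  finally have "(\<Sum>a<M. \<Sum>b<M. A a b) = 0"
    by (simp add: circ sum_negf)
  moreover have "(\<Sum>a<M. \<Sum>b<M. A a b)
    = 2 * pi * (of_int (\<Sum>a<M. x (Suc a) - x a) * of_int (\<Sum>b<M. y (Suc b) - y b) / of_nat (N^2))"
    unfolding A_def of_int_sum sum_product by (simp add: sum_distrib_left sum_divide_distrib)
  moreover have "(\<Sum>a<M. x (Suc a) - x a) = int N" "(\<Sum>b<M. y (Suc b) - y b) = int N"
    unfolding sum_lessThan_telescope x(1) y(1) by simp_all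
  ultimately show False
    using N by (simp add: power2_eq_square)
qed

subsection \<open>Second differences at dyadic steps\<close>

definition second_diff :: "int \<Rightarrow> (int \<Rightarrow> complex) \<Rightarrow> int \<Rightarrow> complex" where
  "second_diff s b j = b (j + s) - 2 * b j + b (j - s)"

definition diff_energy :: "nat \<Rightarrow> (int \<Rightarrow> complex) \<Rightarrow> nat \<Rightarrow> real" where
  "diff_energy N b s = (\<Sum>j\<in>{0..<int (N^2)}. (cmod (b (j + int s) - b j))^2)"

definition second_diff_energy :: "nat \<Rightarrow> (int \<Rightarrow> complex) \<Rightarrow> nat \<Rightarrow> real" where
  "second_diff_energy N b s = (\<Sum>j\<in>{0..<int (N^2)}. (cmod (second_diff (int s) b j))^2)"

lemma ell2_shift: "b \<in> ell2 N \<Longrightarrow> (\<lambda>j. b (j + s)) \<in> ell2 N"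
  unfolding ell2_def mem_Collect_eq by (metis add.commute add.left_commute)

lemma second_diff_ell2: "b \<in> ell2 N \<Longrightarrow> second_diff s b \<in> ell2 N"
  using ell2_shift[of b N s] ell2_shift[of b N "-s"] by (simp add: ell2_def second_diff_def)

lemma zak_second_diff:
  "zak N (second_diff s b) m n = zak N b (m + s) n - 2 * zak N b m n + zak N b (m - s) n"
proof -
  have *: "m + s - int N * k = m - int N * k + s" "m - s - int N * k = m - int N * k - s" for k by simp_all
  show ?thesis
    unfolding zak_def second_diff_def *
    by (simp add: sum.distrib sum_subtractf sum_distrib_left algebra_simps)
qed

lemma sum_ell2_shift:
  assumes "N > 0" "b \<in> ell2 N"
  shows "(\<Sum>j\<in>{0..<int (N^2)}. (cmod (b (j + s + t) - b (j + t)))^2)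
    = (\<Sum>j\<in>{0..<int (N^2)}. (cmod (b (j + s) - b j))^2)"
proof -
  let ?f = "\<lambda>j. (cmod (b (j + s) - b j))^2"
  have "?f (j + int (N^2)) = ?f j" for j
    using ell2_periodic[OF assms(2), of "j + s"] ell2_periodic[OF assms(2), of j] by (simp add: algebra_simps)
  then have "(\<Sum>j\<in>{0..<int (N^2)}. ?f (j + t)) = (\<Sum>j\<in>{0..<int (N^2)}. ?f j)"
    using assms(1) by (intro sum_periodic_shift) auto
  then show ?thesis by (simp add: algebra_simps)
qed

text \<open>The parallelogram law at each point; translation invariance of sums over a period then
  identifies the three terms.\<close>

lemma second_diff_energy_parallelogram:
  assumes "N > 0" "b \<in> ell2 N"
  shows "second_diff_energy N b s = 4 * diff_energy N b s - diff_energy N b (2 * s)"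
proof -
  have par: "(cmod (x - 2 * y + z))^2 = 2 * (cmod (x - y))^2 + 2 * (cmod (y - z))^2 - (cmod (x - z))^2" for x y z
    unfolding cmod_power2 by (simp add: power2_eq_square algebra_simps)
  have eqs: "j + int s + (- int s) = j" "j + 2 * int s + (- int s) = j + int s" for j
    by simp_all
  have "second_diff_energy N b s = 2 * (\<Sum>j\<in>{0..<int (N^2)}. (cmod (b (j + int s) - b j))^2)
    + 2 * (\<Sum>j\<in>{0..<int (N^2)}. (cmod (b (j + int s + (- int s)) - b (j + (- int s))))^2)
    - (\<Sum>j\<in>{0..<int (N^2)}. (cmod (b (j + 2 * int s + (- int s)) - b (j + (- int s))))^2)"
    unfolding second_diff_energy_def second_diff_def par eqs by (simp add: sum.distrib sum_subtractf sum_distrib_left)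
  then show ?thesis
    unfolding sum_ell2_shift[OF assms] by (simp add: diff_energy_def algebra_simps)
qed

text \<open>The square roots are L2 norms, and the differences at steps \<open>s + 1\<close> and
  \<open>s\<close> differ by a translate of the difference at step 1, so the triangle inequality
  applies both ways.\<close>

lemma sqrt_diff_energy_step:
  assumes "N > 0" "b \<in> ell2 N"
  shows "\<bar>sqrt (diff_energy N b (Suc s)) - sqrt (diff_energy N b s)\<bar> \<le> sqrt (diff_energy N b 1)"
proof -
  let ?A = "{0..<int (N^2)}"
  let ?f = "\<lambda>j. cmod (b (j + int s + 1) - b j)" and ?g = "\<lambda>j. cmod (b (j + int s) - b j)"
    and ?h = "\<lambda>j. cmod (b (j + 1 + int s) - b (j + int s))"
  have f: "sqrt (diff_energy N b (Suc s)) = L2_set ?f ?A"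
    and g: "sqrt (diff_energy N b s) = L2_set ?g ?A"
    by (simp_all add: diff_energy_def L2_set_def algebra_simps)
  have h: "sqrt (diff_energy N b 1) = L2_set ?h ?A"
    using sum_ell2_shift[OF assms, of 1 "int s"] by (simp add: diff_energy_def L2_set_def)
  have "L2_set ?f ?A \<le> L2_set (\<lambda>j. ?g j + ?h j) ?A"
  proof (rule L2_set_mono)
    fix j
    have "b (j + int s + 1) - b j = (b (j + int s) - b j) + (b (j + 1 + int s) - b (j + int s))"
      by (simp add: algebra_simps)
    then show "?f j \<le> ?g j + ?h j" by (metis norm_triangle_ineq)
  qed auto
  also have "\<dots> \<le> L2_set ?g ?A + L2_set ?h ?A"
    by (rule L2_set_triangle_ineq)
  finally have 1: "L2_set ?f ?A \<le> L2_set ?g ?A + L2_set ?h ?A" .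
  have "L2_set ?g ?A \<le> L2_set (\<lambda>j. ?f j + ?h j) ?A"
  proof (rule L2_set_mono)
    fix j
    have "b (j + int s) - b j = (b (j + int s + 1) - b j) - (b (j + 1 + int s) - b (j + int s))"
      by (simp add: algebra_simps)
    then show "?g j \<le> ?f j + ?h j" by (metis norm_triangle_ineq4)
  qed auto
  also have "\<dots> \<le> L2_set ?f ?A + L2_set ?h ?A"
    by (rule L2_set_triangle_ineq)
  finally show ?thesis
    using 1 unfolding f g h by linarith
qed

text \<open>Here \<open>h s\<close> will be the square root of the first difference energy at step
  \<open>s\<close>, and \<open>t i\<close> an integer near \<open>N / 2 ^ i\<close>. If
  \<open>t i\<close> were exactly \<open>2 * t (Suc i)\<close>, the weights would make the sum
  telescope; rounding changes \<open>h\<close> by at most \<open>c\<close>, and these errors add up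
  to a multiple of \<open>N^2 * c^2\<close>.\<close>

lemma dyadic_telescope:
  fixes h :: "nat \<Rightarrow> real" and t :: "nat \<Rightarrow> nat"
  assumes h: "\<And>s. 0 \<le> h s" "h 0 = 0" "\<And>s. \<bar>h (Suc s) - h s\<bar> \<le> c"
    and t: "\<And>i. t i = 2 * t (Suc i) \<or> t i = Suc (2 * t (Suc i)) \<or> Suc (t i) = 2 * t (Suc i)"
    and t_le: "\<And>i. i \<le> K \<Longrightarrow> t i * 2 ^ i \<le> 2 * N" and K: "2 ^ K \<le> N"
  shows "(\<Sum>i<K. 4 ^ Suc i * (4 * (h (t (Suc i)))^2 - (h (2 * t (Suc i)))^2)) \<le> 34 * (of_nat N)^2 * c^2"
proof -
  have c: "0 \<le> c" using h(3)[of 0] by linarith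
  have lin: "h s \<le> of_nat s * c" for s
  proof (induction s)
    case (Suc s)
    then show ?case using h(3)[of s] by (simp add: algebra_simps)
  qed (simp add: h)
  have step: "(h (t i))^2 \<le> (h (2 * t (Suc i)))^2 + (4 * of_nat (t (Suc i)) + 1) * c^2" for i
  proof -
    have le: "h (t i) \<le> h (2 * t (Suc i)) + c"
      using t[of i] h(3)[of "2 * t (Suc i)"] h(3)[of "t i"] c by (elim disjE) auto
    have "(h (t i))^2 \<le> (h (2 * t (Suc i)) + c)^2"
      using le h(1) by (intro power_mono) auto
    also have "\<dots> = (h (2 * t (Suc i)))^2 + 2 * c * h (2 * t (Suc i)) + c^2"
      by (simp add: power2_eq_square algebra_simps)
    also have "2 * c * h (2 * t (Suc i)) \<le> 2 * c * (of_nat (2 * t (Suc i)) * c)"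
      using lin[of "2 * t (Suc i)"] c by (intro mult_left_mono) auto
    finally show ?thesis by (simp add: power2_eq_square algebra_simps)
  qed
  \<comment> \<open>The rounding error at level \<open>k\<close> is of order
    \<open>2 ^ k * N + 4 ^ k\<close>. It grows geometrically, so the accumulated error stays
    comparable to its last term.\<close>
  have tel: "(\<Sum>i<k. 4 ^ Suc i * (4 * (h (t (Suc i)))^2 - (h (2 * t (Suc i)))^2))
    \<le> 4 ^ Suc k * (h (t k))^2 + (16 * of_nat N * 2 ^ k + 2 * 4 ^ k) * c^2" if "k \<le> K" for k
    using that
  proof (induction k)
    case (Suc k)
    have "t (Suc k) * 2 ^ k \<le> N" using t_le[OF Suc.prems] by simp
    then have "real (t (Suc k)) * 2 ^ k \<le> real N"
      by (metis of_nat_le_iff of_nat_mult of_nat_numeral of_nat_power)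
    then have le: "16 * 2 ^ k * (real (t (Suc k)) * 2 ^ k) \<le> 16 * 2 ^ k * real N"
      by (intro mult_left_mono) auto
    have four: "(4::real) ^ k = 2 ^ k * 2 ^ k"
      by (simp add: power_mult_distrib[symmetric])
    have "(4::real) ^ Suc k * (4 * real (t (Suc k)) + 1) = 16 * 2 ^ k * (real (t (Suc k)) * 2 ^ k) + 4 * 4 ^ k"
      unfolding four power_Suc by (simp add: algebra_simps)
    also have "\<dots> \<le> 16 * 2 ^ k * real N + 6 * 4 ^ k"
      using le by (intro add_mono) auto
    also have "\<dots> = 16 * real N * 2 ^ k + 6 * 4 ^ k" by simp
    finally have "4 ^ Suc k * (4 * real (t (Suc k)) + 1) * c^2 \<le> (16 * real N * 2 ^ k + 6 * 4 ^ k) * c^2"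
      by (rule mult_right_mono) auto
    moreover have "4 ^ Suc k * (h (t k))^2
      \<le> 4 ^ Suc k * ((h (2 * t (Suc k)))^2 + (4 * of_nat (t (Suc k)) + 1) * c^2)"
      using step by (intro mult_left_mono) auto
    ultimately show ?case
      using Suc by (simp add: algebra_simps)
  qed simp
  \<comment> \<open>The boundary term is at most \<open>16 * N^2 * c^2\<close> and the accumulated
    error at most \<open>(16 + 2) * N^2 * c^2\<close>, whence 34.\<close>
  have "(real (t K) * 2 ^ K)^2 \<le> (2 * real N)^2"
  proof (rule power_mono)
    show "real (t K) * 2 ^ K \<le> 2 * real N"
      using of_nat_mono[OF t_le[of K], where 'a = real] by simp
  qed auto
  then have "4 * (real (t K) * 2 ^ K)^2 * c^2 \<le> 4 * (2 * real N)^2 * c^2"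
    by (intro mult_right_mono mult_left_mono) auto
  moreover have "4 ^ Suc K * (h (t K))^2 \<le> 4 ^ Suc K * (real (t K) * c)^2"
    using lin h(1) by (intro mult_left_mono power_mono) auto
  moreover have four: "(4::real) ^ K = (2 ^ K)^2"
    by (simp add: power_mult[symmetric] mult.commute[of K] power_mult[of 2 2 K, simplified])
  moreover have "real (2 ^ K) \<le> real N" using K by (rule of_nat_mono)
  then have "(2::real) ^ K \<le> real N" by simp
  then have "(16 * real N * 2 ^ K + 2 * (2 ^ K)^2) * c^2 \<le> (16 * real N * real N + 2 * (real N)^2) * c^2"
    by (intro mult_right_mono add_mono mult_left_mono power_mono) auto
  moreover have "4 ^ Suc K * (real (t K) * c)^2 = 4 * (real (t K) * 2 ^ K)^2 * c^2"
    by (simp add: four power_mult_distrib)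
  moreover have "4 * (2 * real N)^2 * c^2 + (16 * real N * real N + 2 * (real N)^2) * c^2 = 34 * (real N)^2 * c^2"
    by (simp add: power2_eq_square algebra_simps)
  ultimately show ?thesis
    using tel[of K] unfolding four by linarith
qed

text \<open>The two values of \<open>e\<close> cover both gap lengths that occur in a grid of
  \<open>2 ^ Suc i\<close> nearly equally spaced points.\<close>

lemma second_diff_energy_sum_le:
  assumes "N > 0" "b \<in> ell2 N" and K: "2 ^ K \<le> N" and e: "e \<le> (1::nat)"
  shows "(\<Sum>i<K. 4 ^ Suc i * second_diff_energy N b (N div 2 ^ Suc i + e)) \<le> 34 * (of_nat N)^2 * diff_energy N b 1"
proof -
  let ?t = "\<lambda>i. N div 2 ^ i + e"
  have nn: "0 \<le> diff_energy N b s" for s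
    by (simp add: diff_energy_def sum_nonneg)
  have "(\<Sum>i<K. 4 ^ Suc i * (4 * (sqrt (diff_energy N b (?t (Suc i))))^2 - (sqrt (diff_energy N b (2 * ?t (Suc i))))^2))
      \<le> 34 * (of_nat N)^2 * (sqrt (diff_energy N b 1))^2"
  proof (rule dyadic_telescope)
    fix i
    define q where "q = N div 2 ^ i"
    have q: "N div 2 ^ Suc i = q div 2"
      by (simp add: q_def div_mult2_eq[symmetric] mult.commute)
    show "?t i = 2 * ?t (Suc i) \<or> ?t i = Suc (2 * ?t (Suc i)) \<or> Suc (?t i) = 2 * ?t (Suc i)"
      unfolding q q_def[symmetric] using e by presburger
  next
    fix i assume "i \<le> K"
    then have "2 ^ i \<le> N" using K power_increasing[of i K "2::nat"] by linarith
    then have "e * 2 ^ i \<le> N" using mult_right_mono[OF e, of "2 ^ i"] by linarith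
    moreover have "N div 2 ^ i * 2 ^ i \<le> N" by (rule div_times_less_eq_dividend)
    ultimately show "?t i * 2 ^ i \<le> 2 * N" unfolding add_mult_distrib by linarith
  next
    fix s
    show "\<bar>sqrt (diff_energy N b (Suc s)) - sqrt (diff_energy N b s)\<bar> \<le> sqrt (diff_energy N b 1)"
      by (rule sqrt_diff_energy_step[OF assms(1,2)])
  qed (use K nn in \<open>simp_all add: diff_energy_def\<close>)
  then show ?thesis
    unfolding second_diff_energy_parallelogram[OF assms(1,2)] real_sqrt_pow2[OF nn] .
qed

subsection \<open>The lower bound\<close>

lemma zak_second_diff_norm_periodic:
  assumes "N > 0" "b \<in> ell2 N"
  shows "cmod (zak N (second_diff s b) (m + int N) n) = cmod (zak N (second_diff s b) m n)"
  by (rule norm_zak_periodic[OF assms(1) second_diff_ell2[OF assms(2)]])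

text \<open>By \<open>zak_fourier\<close> the second summand is a second difference in
  \<open>n\<close> of the Zak transform of \<open>b\<close> times a unimodular phase, so both
  directions are measured.\<close>

definition zak_roughness :: "nat \<Rightarrow> (int \<Rightarrow> complex) \<Rightarrow> nat \<Rightarrow> int \<Rightarrow> int \<Rightarrow> real" where
  "zak_roughness N b s m n = (cmod (zak N (second_diff (int s) b) m n))^2
     + (cmod (zak N (second_diff (int s) (fourier_d N b)) n (- m)))^2"

lemma zak_roughness_periodic:
  assumes "N > 0" "b \<in> ell2 N"
  shows "zak_roughness N b s (m + int N) n = zak_roughness N b s m n"
    and "zak_roughness N b s m (n + int N) = zak_roughness N b s m n"
proof -
  have "zak N c n (- (m + int N)) = zak N c n (- m)" for c
    using zak_periodic[OF assms(1), of c n "- m - int N"] by simp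
  then show "zak_roughness N b s (m + int N) n = zak_roughness N b s m n"
    unfolding zak_roughness_def zak_second_diff_norm_periodic[OF assms] by (simp only:)
  show "zak_roughness N b s m (n + int N) = zak_roughness N b s m n"
    unfolding zak_roughness_def zak_periodic[OF assms(1)]
      zak_second_diff_norm_periodic[OF assms(1) fourier_d_ell2[OF assms(1)]] ..
qed

lemma sum_zak_roughness:
  assumes "N > 0" "b \<in> ell2 N"
  shows "(\<Sum>m\<in>{0..<int N}. \<Sum>n\<in>{0..<int N}. zak_roughness N b s m n)
    = of_nat N * (second_diff_energy N b s + second_diff_energy N (fourier_d N b) s)"
proof -
  let ?I = "{0..<int N}" and ?c = "second_diff (int s) (fourier_d N b)"
  have "(\<Sum>m\<in>?I. (cmod (zak N ?c n (0 - m)))^2) = (\<Sum>m\<in>?I. (cmod (zak N ?c n m))^2)" for n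
    by (rule sum_periodic_reflect) (use assms in \<open>simp_all add: zak_periodic\<close>)
  then have "(\<Sum>m\<in>?I. \<Sum>n\<in>?I. (cmod (zak N ?c n (- m)))^2) = (\<Sum>n\<in>?I. \<Sum>m\<in>?I. (cmod (zak N ?c n m))^2)"
    by (subst sum.swap) simp
  then show ?thesis
    unfolding zak_roughness_def sum.distrib second_diff_energy_def
    using zak_parseval[OF assms(1) second_diff_ell2[OF assms(2)]]
      zak_parseval[OF assms(1) second_diff_ell2[OF fourier_d_ell2[OF assms(1)]]]
    by (simp add: distrib_left)
qed

text \<open>The grid points are the floors of \<open>a * N / M\<close>. The bound
  \<open>3 * g \<le> 2 * N\<close> is the one the circulation argument asks for; it is attained for
  \<open>M = 2\<close> and \<open>N = 3\<close>.\<close>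

lemma equipartition_gap:
  fixes N M a :: nat
  assumes "2 \<le> M" "M \<le> N"
  defines "g \<equiv> Suc a * N div M - a * N div M"
  shows "a * N div M < Suc a * N div M" "g = N div M \<or> g = Suc (N div M)" "3 * g \<le> 2 * N"
proof -
  have eq: "Suc a * N div M = a * N div M + N div M + (a * N mod M + N mod M) div M"
    using div_add1_eq[of "a * N" N M] by (simp add: add_ac)
  have pos: "1 \<le> N div M"
    using assms by (simp add: Suc_le_eq div_greater_zero_iff)
  have "a * N mod M + N mod M < 2 * M"
    using assms mod_less_divisor[of M "a * N"] mod_less_divisor[of M N] by linarith
  then have le1: "(a * N mod M + N mod M) div M \<le> 1"
    using less_mult_imp_div_less[of "a * N mod M + N mod M" 2 M] by simp
  then show g: "g = N div M \<or> g = Suc (N div M)"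
    unfolding g_def eq by auto
  show "a * N div M < Suc a * N div M"
    unfolding eq using pos by simp
  have "2 * g \<le> N + 1"
  proof (cases "N mod M = 0")
    case True
    then have "g = N div M"
      using assms unfolding g_def eq by simp
    moreover have "N div M * M \<le> N" by simp
    moreover have "N div M * 2 \<le> N div M * M" using assms by simp
    ultimately show ?thesis by linarith
  next
    case False
    have "N div M * M + N mod M = N" by simp
    moreover have "N div M * 2 \<le> N div M * M" using assms by simp
    ultimately show ?thesis using False g by linarith
  qed
  moreover have "2 \<le> N" using assms by simp
  \<comment> \<open>For \<open>N \<ge> 3\<close> this is linear in \<open>2 * g \<le> N + 1\<close>;
    for \<open>N = 2\<close> it uses that \<open>g\<close> is an integer.\<close>
  ultimately show "3 * g \<le> 2 * N"
    by (cases "N = 2") auto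
qed

text \<open>The grid has a jump across a gap of one of two lengths, and
  \<open>second_diff_unimodular\<close>, read contrapositively, makes it a second difference at that
  step. Adding both roughnesses avoids tracking which length occurs.\<close>

lemma zak_roughness_grid:
  assumes N: "b \<in> ell2 N" and M: "2 \<le> M" "M \<le> N"
    and unimod: "\<And>m n. cmod (zak N b m n) = 1"
  shows "\<exists>a<M. \<exists>k<M. 1/16 \<le> zak_roughness N b (N div M) (u + int (a * N div M)) (v + int (k * N div M))
      + zak_roughness N b (Suc (N div M)) (u + int (a * N div M)) (v + int (k * N div M))"
proof -
  have N0: "N > 0" using M by simp
  let ?X = "zak N b" and ?Y = "zak N (fourier_d N b)"
  define U where "U m n = ?Y n (- m)" for m n
  define x y where "x a = u + int (a * N div M)" and "y a = v + int (a * N div M)" for a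
  have U: "U m n = ec (- (of_int m * of_int n / of_nat (N^2))) * ?X m n" for m n
    unfolding U_def zak_fourier[OF N0 N] by (simp add: mult.commute)
  have U_per: "U (m + int N) n = U m n" for m n
    unfolding U_def using zak_periodic[OF N0, of "fourier_d N b" n "- m - int N"] by simp
  have U_norm: "cmod (U m n) = 1" for m n
    by (simp add: U norm_mult unimod)
  have ends: "x M = x 0 + int N" "y M = y 0 + int N"
    using M by (simp_all add: x_def y_def)
  have gap_eq: "x (Suc a) - x a = int (Suc a * N div M - a * N div M)"
    "y (Suc a) - y a = int (Suc a * N div M - a * N div M)" for a
    using equipartition_gap(1)[OF M, of a] by (simp_all add: x_def y_def of_nat_diff del: mult_Suc)
  have gap: "0 < x (Suc a) - x a" "3 * (x (Suc a) - x a) \<le> 2 * int N"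
    "0 < y (Suc a) - y a" "3 * (y (Suc a) - y a) \<le> 2 * int N" for a
    using equipartition_gap(1,3)[OF M, of a] unfolding gap_eq by linarith+
  obtain a k where ak: "a < M" "k < M" and jump:
    "1/2 \<le> (cmod (?X (x (Suc a)) (y k) - ?X (x a) (y k)))^2
      \<or> 1/2 \<le> (cmod (U (x a) (y (Suc k)) - U (x a) (y k)))^2"
    using quasi_periodic_grid_jump[of N ?X U x M y, OF N0 unimod zak_periodic[OF N0] U_per U ends(1) gap(1,2) ends(2) gap(3,4)]
    by blast
  have nn: "0 \<le> zak_roughness N b s m n" for s m n
    by (simp add: zak_roughness_def)
  have rough_X: "1/16 \<le> zak_roughness N b s m n" if "1/2 \<le> (cmod (?X (m + int s) n - ?X m n))^2" for s m n
  proof -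
    have "1/16 \<le> (cmod (?X (m + int s) n - 2 * ?X m n + ?X (m - int s) n))^2"
      using second_diff_unimodular[OF unimod unimod unimod, of "m + int s" n m n "m - int s" n] that by linarith
    then show ?thesis
      unfolding zak_roughness_def zak_second_diff by (rule add_increasing2[rotated]) simp
  qed
  have rough_U: "1/16 \<le> zak_roughness N b s m n" if "1/2 \<le> (cmod (U m (n + int s) - U m n))^2" for s m n
  proof -
    have "1/16 \<le> (cmod (U m (n + int s) - 2 * U m n + U m (n - int s)))^2"
      using second_diff_unimodular[OF U_norm U_norm U_norm, of m "n + int s" m n m "n - int s"] that by linarith
    then show ?thesis
      unfolding zak_roughness_def zak_second_diff U_def by (rule add_increasing[rotated]) simp
  qed
  have gx: "x (Suc a) = x a + int (N div M) \<or> x (Suc a) = x a + int (Suc (N div M))"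
    and gy: "y (Suc k) = y k + int (N div M) \<or> y (Suc k) = y k + int (Suc (N div M))"
    using equipartition_gap(2)[OF M, of a] equipartition_gap(2)[OF M, of k] gap_eq[of a] gap_eq[of k] by linarith+
  have "1/16 \<le> zak_roughness N b (N div M) (x a) (y k) \<or> 1/16 \<le> zak_roughness N b (Suc (N div M)) (x a) (y k)"
    using jump gx gy rough_X[of "x a" _ "y k"] rough_U[of "x a" "y k"] by metis
  then have "1/16 \<le> zak_roughness N b (N div M) (x a) (y k) + zak_roughness N b (Suc (N div M)) (x a) (y k)"
    using nn[of "N div M" "x a" "y k"] nn[of "Suc (N div M)" "x a" "y k"] by linarith
  then show ?thesis
    using ak unfolding x_def y_def by blast
qed

text \<open>Averaging over all translates \<open>(u, v)\<close> of the grid: each of its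
  \<open>M^2\<close> points sweeps out the whole period cell, so the total roughness of the cell is
  counted \<open>M^2\<close> times.\<close>

lemma second_diff_energy_lower_bound:
  assumes N: "b \<in> ell2 N" and M: "2 \<le> M" "M \<le> N"
    and unimod: "\<And>m n. cmod (zak N b m n) = 1"
  shows "of_nat N / 16 \<le> (of_nat M)^2 *
    (second_diff_energy N b (N div M) + second_diff_energy N (fourier_d N b) (N div M)
     + (second_diff_energy N b (Suc (N div M)) + second_diff_energy N (fourier_d N b) (Suc (N div M))))"
    (is "_ \<le> _ * ?E")
proof -
  have N0: "N > 0" using M by simp
  let ?I = "{0..<int N}"
  define G where "G m n = zak_roughness N b (N div M) m n + zak_roughness N b (Suc (N div M)) m n" for m n
  define x where "x a = int (a * N div M)" for a
  have G_nn: "0 \<le> G m n" for m n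
    by (simp add: G_def zak_roughness_def)
  have G_per: "G (m + int N) n = G m n" "G m (n + int N) = G m n" for m n
    by (simp_all add: G_def zak_roughness_periodic[OF N0 N])
  have G_shift: "(\<Sum>u\<in>?I. \<Sum>v\<in>?I. G (u + p) (v + q)) = (\<Sum>u\<in>?I. \<Sum>v\<in>?I. G u v)" for p q
  proof -
    have "(\<Sum>v\<in>?I. G u (v + q)) = (\<Sum>v\<in>?I. G u v)" for u
      by (rule sum_periodic_shift) (use N0 G_per in auto)
    moreover have "(\<Sum>u\<in>?I. (\<Sum>v\<in>?I. G (u + p) v)) = (\<Sum>u\<in>?I. \<Sum>v\<in>?I. G u v)"
      by (rule sum_periodic_shift[of _ "\<lambda>u. \<Sum>v\<in>?I. G u v"]) (use N0 G_per in auto)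
    ultimately show ?thesis by simp
  qed
  have grid: "1/16 \<le> (\<Sum>a<M. \<Sum>k<M. G (u + x a) (v + x k))" for u v
  proof -
    obtain a k where ak: "a < M" "k < M" "1/16 \<le> G (u + x a) (v + x k)"
      using zak_roughness_grid[OF N M unimod, of u v] unfolding G_def x_def by blast
    note ak(3)
    also have "G (u + x a) (v + x k) \<le> (\<Sum>k<M. G (u + x a) (v + x k))"
      using ak G_nn by (intro member_le_sum[of k "{..<M}" "\<lambda>k. G (u + x a) (v + x k)"]) auto
    also have "\<dots> \<le> (\<Sum>a<M. \<Sum>k<M. G (u + x a) (v + x k))"
      using ak G_nn by (intro member_le_sum[of a "{..<M}" "\<lambda>a. \<Sum>k<M. G (u + x a) (v + x k)"] sum_nonneg) auto
    finally show ?thesis .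
  qed
  have "of_nat N * of_nat N / 16 = (\<Sum>u\<in>?I. \<Sum>v\<in>?I. 1/16 :: real)"
    by simp
  also have "\<dots> \<le> (\<Sum>u\<in>?I. \<Sum>v\<in>?I. \<Sum>a<M. \<Sum>k<M. G (u + x a) (v + x k))"
    by (intro sum_mono grid)
  also have "\<dots> = (\<Sum>u\<in>?I. \<Sum>a<M. \<Sum>k<M. \<Sum>v\<in>?I. G (u + x a) (v + x k))"
    by (subst (2) sum.swap, subst (3) sum.swap) (rule refl)
  also have "\<dots> = (\<Sum>a<M. \<Sum>k<M. \<Sum>u\<in>?I. \<Sum>v\<in>?I. G (u + x a) (v + x k))"
    by (subst sum.swap, subst (2) sum.swap) (rule refl)
  also have "\<dots> = (of_nat M)^2 * (\<Sum>u\<in>?I. \<Sum>v\<in>?I. G u v)"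
    unfolding G_shift by (simp add: power2_eq_square)
  also have "\<dots> = (of_nat M)^2 * (of_nat N * ?E)"
    unfolding G_def sum.distrib sum_zak_roughness[OF N0 N] by (simp add: distrib_left)
  finally have "of_nat N * (of_nat N / 16) \<le> of_nat N * ((of_nat M)^2 * ?E)"
    by (simp add: mult_ac)
  then show ?thesis
    by (rule mult_left_le_imp_le) (use N0 in simp)
qed

section \<open>The energy functional and its logarithmic lower bound\<close>

definition gabor_energy :: "nat \<Rightarrow> (int \<Rightarrow> complex) \<Rightarrow> real" where
  "gabor_energy N b = (norm_d N (\<lambda>j. of_nat N * Delta b j))^2
     + (norm_d N (\<lambda>k. of_nat N * Delta (fourier_d N b) k))^2"

lemma norm_d_Delta:
  assumes "N > 0"
  shows "(norm_d N (\<lambda>j. of_nat N * Delta b j))^2 = of_nat N * diff_energy N b 1"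
proof -
  have "(norm_d N (\<lambda>j. of_nat N * Delta b j))^2
    = (1 / real N) * (\<Sum>j\<in>{0..<int (N^2)}. (cmod (of_nat N * Delta b j))^2)"
    unfolding norm_d_def by (rule real_sqrt_pow2) (simp add: sum_nonneg)
  also have "\<dots> = (1 / real N) * ((real N)^2 * diff_energy N b 1)"
    by (simp add: Delta_def diff_energy_def norm_mult power_mult_distrib sum_distrib_left)
  also have "\<dots> = of_nat N * diff_energy N b 1"
    using assms by (simp add: power2_eq_square)
  finally show ?thesis .
qed

text \<open>Each of the \<open>K\<close> scales \<open>M = 2 ^ Suc i\<close> contributes at least
  \<open>N / 16\<close>, and the telescoped total is at most \<open>68 * N\<close> times the energy,
  so \<open>K\<close> is at most \<open>16 * 68 = 1088\<close> times the energy. A factor 2 pays for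
  \<open>ln N \<le> Suc K \<le> 2 * K\<close>.\<close>

lemma gabor_energy_lower_bound:
  assumes N: "b \<in> ell2 N" "2 \<le> N" and unimod: "\<And>m n. cmod (zak N b m n) = 1"
  shows "ln (real N) / 2176 \<le> gabor_energy N b"
proof -
  have N0: "N > 0" using N by simp
  let ?c = "fourier_d N b"
  have c: "?c \<in> ell2 N" by (rule fourier_d_ell2[OF N0])
  obtain K where K: "2 ^ K \<le> N" "N < 2 ^ Suc K"
    using ex_power_ivl1[of 2 N] N0 by auto
  have "K \<noteq> 0" using K N by (intro notI) simp
  let ?E = "\<lambda>f e i. 4 ^ Suc i * second_diff_energy N f (N div 2 ^ Suc i + e)"
  have "real K * (real N / 16) = (\<Sum>i<K. real N / 16)" by simp
  also have "\<dots> \<le> (\<Sum>i<K. ?E b 0 i + ?E ?c 0 i + (?E b 1 i + ?E ?c 1 i))"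
  proof (rule sum_mono)
    fix i assume "i \<in> {..<K}"
    then have "(2::nat) ^ Suc i \<le> 2 ^ K" by (intro power_increasing) auto
    then have le: "2 ^ Suc i \<le> N" using K by linarith
    have "(real (2 ^ Suc i))^2 = 4 ^ Suc i"
      by (simp add: power2_eq_square power_mult_distrib[symmetric])
    then show "real N / 16 \<le> ?E b 0 i + ?E ?c 0 i + (?E b 1 i + ?E ?c 1 i)"
      using second_diff_energy_lower_bound[OF N(1) _ le unimod] by (simp add: distrib_left)
  qed
  also have "\<dots> \<le> 34 * (of_nat N)^2 * diff_energy N b 1 + 34 * (of_nat N)^2 * diff_energy N ?c 1
    + (34 * (of_nat N)^2 * diff_energy N b 1 + 34 * (of_nat N)^2 * diff_energy N ?c 1)"
    unfolding sum.distrib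
    by (intro add_mono second_diff_energy_sum_le N0 N(1) c K) simp_all
  also have "\<dots> = 68 * real N * gabor_energy N b"
    unfolding gabor_energy_def norm_d_Delta[OF N0] by (simp add: power2_eq_square algebra_simps)
  finally have "real N * real K \<le> real N * (1088 * gabor_energy N b)"
    by (simp add: mult_ac)
  then have *: "real K \<le> 1088 * gabor_energy N b"
    using N0 by simp
  have "ln (real N) \<le> ln (2 ^ Suc K)"
    using of_nat_mono[OF less_imp_le[OF K(2)], where 'a = real] N0 by simp
  also have "\<dots> = real (Suc K) * ln 2" by (rule ln_realpow)
  also have "\<dots> \<le> real (Suc K) * 1"
    using ln_le_minus_one[of 2] by (intro mult_left_mono) auto
  also have "\<dots> \<le> 2 * real K" using \<open>K \<noteq> 0\<close> by simp
  finally show ?thesis using * by linarith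
qed

subsection \<open>A window with a single vortex\<close>

lemma norm_ec_diff_le: "cmod (ec s - ec t) \<le> 2 * pi * \<bar>s - t\<bar>"
proof -
  have "ec s - ec t = ec t * (ec (s - t) - 1)"
    using ec_add[of t "s - t"] by (simp add: algebra_simps)
  then have "(cmod (ec s - ec t))^2 = (cmod (ec (s - t) - 1))^2"
    by (simp add: norm_mult)
  also have "\<dots> = 2 - 2 * cos (2 * (pi * (s - t)))"
    by (subst norm_diff_one_square) (simp_all add: ec_def mult.assoc)
  also have "\<dots> = (2 * \<bar>sin (pi * (s - t))\<bar>)^2"
    by (simp add: cos_double_sin power_mult_distrib)
  also have "\<dots> \<le> (2 * \<bar>pi * (s - t)\<bar>)^2"
    by (intro power_mono mult_left_mono abs_sin_x_le_abs_x) auto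
  finally have "cmod (ec s - ec t) \<le> 2 * \<bar>pi * (s - t)\<bar>"
    by (rule power2_le_imp_le) simp
  then show ?thesis by (simp add: abs_mult)
qed

text \<open>Halving the angle: \<open>sin s = 2 * sin t * cos t\<close> with
  \<open>t = s / 2\<close>, where \<open>t * cos t \<le> sin t\<close> and
  \<open>(cos t)^2 \<ge> 1/2\<close> on \<open>[0, pi / 4]\<close>.\<close>

lemma half_le_sin:
  assumes "0 \<le> s" "s \<le> pi / 2"
  shows "s / 2 \<le> sin s"
proof -
  define t where "t = s / 2"
  have t: "0 \<le> t" "t \<le> pi / 4" using assms by (auto simp: t_def)
  have "(\<lambda>t. sin t - t * cos t) 0 \<le> (\<lambda>t. sin t - t * cos t) t"
  proof (rule DERIV_nonneg_imp_nondecreasing[OF t(1)])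
    fix x assume x: "0 \<le> x" "x \<le> t"
    have "((\<lambda>t. sin t - t * cos t) has_real_derivative x * sin x) (at x)"
      by (auto intro!: derivative_eq_intros)
    moreover have "0 \<le> x * sin x"
      using x t pi_gt_zero by (intro mult_nonneg_nonneg sin_ge_zero) auto
    ultimately show "\<exists>y. ((\<lambda>t. sin t - t * cos t) has_real_derivative y) (at x) \<and> 0 \<le> y"
      by blast
  qed
  then have "t * cos t \<le> sin t" by simp
  moreover have c: "0 \<le> cos t" using t by (intro cos_ge_zero) auto
  ultimately have "(t * cos t) * cos t \<le> sin t * cos t"
    by (rule mult_right_mono)
  moreover have "t * (1 / 2) \<le> t * (cos t * cos t)"
  proof (rule mult_left_mono[OF _ t(1)])
    have "0 \<le> cos (2 * t)" using t by (intro cos_ge_zero) auto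
    then show "1 / 2 \<le> cos t * cos t"
      by (simp add: cos_double_cos power2_eq_square)
  qed
  moreover have "sin s = 2 * (sin t * cos t)"
    using sin_double[of t] by (simp add: t_def)
  ultimately show ?thesis
    by (simp add: t_def)
qed

text \<open>Interpolates between the loops \<open>1\<close> and \<open>ec\<close>; the only zero is at the centre \<open>(1/2, 1/2)\<close> of the cell.\<close>

definition vortex :: "real \<Rightarrow> real \<Rightarrow> complex" where
  "vortex x y = of_real (1 - x) + of_real x * ec y"

text \<open>The modulus grows at least linearly with the distance to the zero, which controls the
  normalised function near it.\<close>

lemma norm_vortex_ge:
  assumes x: "0 \<le> x" "x \<le> 1" and y: "0 \<le> y" "y \<le> 1"
  shows "((2 * x - 1)^2 + (2 * y - 1)^2) / 8 \<le> (cmod (vortex x y))^2"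
proof -
  define c where "c = cos (pi * y)"
  have cos2: "cos (2 * pi * y) = 2 * c^2 - 1"
    using cos_double_cos[of "pi * y"] by (simp add: c_def mult.assoc)
  have "(cmod (vortex x y))^2 = (1 - x + x * cos (2 * pi * y))^2 + (x * sin (2 * pi * y))^2"
    by (simp add: vortex_def ec_def cmod_power2)
  also have "\<dots> = (1 - x)^2 + 2 * x * (1 - x) * cos (2 * pi * y) + x^2 * ((sin (2 * pi * y))^2 + (cos (2 * pi * y))^2)"
  proof -
    have "(1 - x + x * C)^2 + (x * S)^2 = (1 - x)^2 + 2 * x * (1 - x) * C + x^2 * (S^2 + C^2)" for C S :: real
      by (simp add: power2_eq_square algebra_simps)
    then show ?thesis by blast
  qed
  also have "\<dots> = (1 - x)^2 + 2 * x * (1 - x) * (2 * c^2 - 1) + x^2"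
    unfolding sin_cos_squared_add unfolding cos2 by simp
  \<comment> \<open>With \<open>u = 2 * x - 1\<close> the square is
    \<open>u^2 + c^2 - u^2 * c^2\<close>; as neither \<open>u^2\<close> nor \<open>c^2\<close>
    exceeds 1, it is at least their mean.\<close>
  also have "\<dots> = (2 * x - 1)^2 / 2 + c^2 / 2 + ((2 * x - 1)^2 * (1 - c^2) + c^2 * (1 - (2 * x - 1)^2)) / 2"
    by (simp add: power2_eq_square field_simps)
  also have "\<dots> \<ge> (2 * x - 1)^2 / 2 + c^2 / 2"
  proof -
    have "\<bar>2 * x - 1\<bar> \<le> 1" using x by linarith
    then have "(2 * x - 1)^2 \<le> 1" by (simp add: abs_square_le_1)
    moreover have "c^2 \<le> 1" by (simp add: c_def abs_square_le_1)
    ultimately show ?thesis by simp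
  qed
  finally have 1: "(2 * x - 1)^2 / 2 + c^2 / 2 \<le> (cmod (vortex x y))^2" .
  \<comment> \<open>The distance of \<open>pi * y\<close> from \<open>pi / 2\<close>, so that
    \<open>sin s\<close> is \<open>|c|\<close>.\<close>
  define s where "s = pi * \<bar>2 * y - 1\<bar> / 2"
  have "pi * \<bar>2 * y - 1\<bar> \<le> pi * 1"
    using y by (intro mult_left_mono) auto
  then have "s / 2 \<le> sin s"
    by (intro half_le_sin) (auto simp: s_def)
  also have "sin s \<le> \<bar>c\<bar>"
  proof (cases "2 * y \<le> 1")
    case True
    then have "s = pi / 2 - pi * y" by (simp add: s_def field_simps)
    then show ?thesis by (simp add: c_def sin_diff)
  next
    case False
    then have "s = pi * y - pi / 2" by (simp add: s_def field_simps)
    then show ?thesis by (simp add: c_def sin_diff)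
  qed
  finally have "s / 2 \<le> \<bar>c\<bar>" .
  moreover have "2 * \<bar>2 * y - 1\<bar> \<le> pi * \<bar>2 * y - 1\<bar>"
    using pi_ge_two by (intro mult_right_mono) auto
  ultimately have "\<bar>2 * y - 1\<bar> / 2 \<le> \<bar>c\<bar>"
    by (simp add: s_def)
  then have "(\<bar>2 * y - 1\<bar> / 2)^2 \<le> \<bar>c\<bar>^2"
    by (intro power_mono) auto
  then have 2: "(2 * y - 1)^2 / 4 \<le> c^2"
    by (simp add: power_divide)
  have "(u + v) / 8 \<le> w" if "v / 4 \<le> t" "u / 2 + t / 2 \<le> w" "0 \<le> u" for t u v w :: real
    using that by (simp add: field_simps)
  from this[OF 2 1 zero_le_power2] show ?thesis .
qed

text \<open>The value 1 at 0 is an arbitrary unimodular choice; for even \<open>N\<close> the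
  sampling grid contains the zero of \<open>vortex\<close>.\<close>

definition unit_part :: "complex \<Rightarrow> complex" where
  "unit_part z = (if z = 0 then 1 else sgn z)"

lemma norm_unit_part [simp]: "cmod (unit_part z) = 1"
  by (simp add: unit_part_def norm_sgn)

lemma unit_part_unimodular: "cmod z = 1 \<Longrightarrow> unit_part z = z"
  by (auto simp: unit_part_def sgn_eq)

text \<open>One \<open>cmod (z - w)\<close> is for the change of the vector and one for the change
  of its length. Multiplying by \<open>cmod z\<close> instead of dividing keeps the bound meaningful
  at zeros.\<close>

lemma norm_unit_part_diff: "cmod (unit_part z - unit_part w) * cmod z \<le> 2 * cmod (z - w)"
proof (cases "z = 0 \<or> w = 0")
  case True
  then show ?thesis
  proof
    assume "w = 0"
    then show ?thesis
      using norm_triangle_ineq4[of "unit_part z" "unit_part w"]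
        mult_right_mono[of "cmod (unit_part z - unit_part w)" 2 "cmod z"] by simp
  qed simp
next
  case False
  then have "(unit_part z - unit_part w) * of_real (cmod z) = (z - w) + sgn w * of_real (cmod w - cmod z)"
    by (simp add: unit_part_def sgn_eq field_simps)
  then have "cmod (unit_part z - unit_part w) * cmod z = cmod ((z - w) + sgn w * of_real (cmod w - cmod z))"
    by (metis abs_norm_cancel norm_mult norm_of_real)
  also have "\<dots> \<le> cmod (z - w) + cmod (sgn w * of_real (cmod w - cmod z))"
    by (rule norm_triangle_ineq)
  also have "cmod (sgn w * of_real (cmod w - cmod z)) \<le> cmod (z - w)"
    using False norm_triangle_ineq3[of w z] by (simp add: norm_mult norm_sgn norm_minus_commute del: of_real_diff)
  finally show ?thesis by simp
qed

text \<open>A cell of the normalised vortex, continued in \<open>m\<close> by the quasi-periodicity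
  of Zak transforms.\<close>

definition vortex_lattice :: "nat \<Rightarrow> int \<Rightarrow> int \<Rightarrow> complex" where
  "vortex_lattice N m n = ec (of_int (m div int N) * of_int n / of_nat N)
     * unit_part (vortex (of_int (m mod int N) / of_nat N) (of_int n / of_nat N))"

lemma norm_vortex_lattice: "cmod (vortex_lattice N m n) = 1"
  by (simp add: vortex_lattice_def norm_mult)

text \<open>At \<open>m = N\<close> the vortex equals \<open>ec (n / N)\<close>, which is the
  quasi-periodicity factor, so neighbouring cells meet without a seam.\<close>

lemma vortex_lattice_cell:
  assumes "0 \<le> m" "m \<le> int N" "N > 0"
  shows "vortex_lattice N m n = unit_part (vortex (of_int m / of_nat N) (of_int n / of_nat N))"
proof (cases "m = int N")
  case True
  then show ?thesis
    using assms by (simp add: vortex_lattice_def vortex_def unit_part_unimodular)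
next
  case False
  then show ?thesis
    using assms by (simp add: vortex_lattice_def)
qed

lemma vortex_lattice_periodic:
  assumes "N > 0"
  shows "vortex_lattice N m (n + int N) = vortex_lattice N m n"
proof -
  have "of_int (n + int N) / of_nat N = of_int n / of_nat N + (of_int 1 :: real)"
    using assms by (simp add: field_simps)
  then have "ec (of_int (n + int N) / of_nat N) = ec (of_int n / of_nat N)"
    by (simp only: ec_add_int)
  then show ?thesis
    unfolding vortex_lattice_def vortex_def ec_periodic_div'[OF assms] by simp
qed

lemma vortex_lattice_shift:
  assumes "N > 0"
  shows "vortex_lattice N (m + int N * k) n = ec (of_int k * of_int n / of_nat N) * vortex_lattice N m n"
  using assms by (simp add: vortex_lattice_def ec_add ring_distribs add_divide_distrib)

section \<open>The window by inversion of the Zak transform\<close>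

definition vortex_window :: "nat \<Rightarrow> int \<Rightarrow> complex" where
  "vortex_window N j = (1 / of_nat N) * (\<Sum>n\<in>{0..<int N}. vortex_lattice N j n)"

lemma vortex_window_ell2:
  assumes "N > 0"
  shows "vortex_window N \<in> ell2 N"
proof -
  have "vortex_lattice N (j + int (N^2)) n = vortex_lattice N j n" for j n
  proof -
    have "of_int (int N) * of_int n / of_nat N = (of_int n :: real)"
      using assms by simp
    then have "ec (of_int (int N) * of_int n / of_nat N) = 1"
      by (simp only: ec_of_int)
    then show ?thesis
      using vortex_lattice_shift[OF assms, of j "int N" n] by (simp add: power2_eq_square)
  qed
  then show ?thesis
    unfolding ell2_def vortex_window_def by simp
qed

lemma zak_vortex_window:
  assumes "N > 0"
  shows "zak N (vortex_window N) m n = vortex_lattice N m n"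
proof -
  let ?I = "{0..<int N}"
  have base: "zak N (vortex_window N) m n = vortex_lattice N m n" if n: "n \<in> ?I" for n
  proof -
    have shift: "vortex_lattice N (m - int N * k) n' = ec (- (of_int n' * of_int k / of_nat N)) * vortex_lattice N m n'" for k n'
      using vortex_lattice_shift[OF assms, of m "- k" n'] by (simp add: mult.commute)
    have "zak N (vortex_window N) m n = (1 / of_nat N) * (\<Sum>k\<in>?I. ec (of_int k * of_int n / of_nat N) *
        (\<Sum>n'\<in>?I. ec (- (of_int n' * of_int k / of_nat N)) * vortex_lattice N m n'))"
      unfolding zak_def vortex_window_def shift by (simp add: sum_distrib_left mult_ac)
    \<comment> \<open>The signs in the exponents are opposite to those of
      \<open>dft_inversion\<close>, hence the conjugation.\<close>
    also have "\<dots> = (1 / of_nat N) * cnj (\<Sum>k\<in>?I. ec (- (of_int k * of_int n / of_nat N)) *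
        (\<Sum>n'\<in>?I. ec (of_int n' * of_int k / of_nat N) * cnj (vortex_lattice N m n')))"
      by (simp add: cnj_ec)
    also have "\<dots> = vortex_lattice N m n"
      unfolding dft_inversion[OF assms n] using assms by simp
    finally show ?thesis .
  qed
  have "zak N (vortex_window N) m n = zak N (vortex_window N) m (n mod int N)"
    by (rule periodic_mod[symmetric]) (rule zak_periodic[OF assms])
  also have "\<dots> = vortex_lattice N m (n mod int N)"
    using assms by (intro base) auto
  also have "\<dots> = vortex_lattice N m n"
    by (rule periodic_mod) (rule vortex_lattice_periodic[OF assms])
  finally show ?thesis .
qed

text \<open>The Lipschitz bound, divided by the lower bound for \<open>cmod z\<close>, gives
  \<open>D^2 * (p^2 + q^2) \<le> 32 * L^2\<close>. Adding the trivial \<open>D^2 \<le> 4\<close>,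
  which serves near the vortex, puts the 1 into the denominator.\<close>

lemma vortex_lattice_diff_le:
  assumes m: "m \<in> {0..<int N}" and n: "n \<in> {0..<int N}" and L: "0 \<le> L"
    and close: "cmod (vortex (of_int m / of_nat N) (of_int n / of_nat N) - w) \<le> L / of_nat N"
  shows "(cmod (unit_part w - vortex_lattice N m n))^2
    \<le> (4 + 32 * L^2) / (1 + (of_int (2 * m - int N))^2 + (of_int (2 * n - int N))^2)"
proof -
  have N: "N > 0" using m by (cases N) auto
  define p q where "p = (of_int (2 * m - int N) :: real)" and "q = (of_int (2 * n - int N) :: real)"
  define z where "z = vortex (of_int m / of_nat N) (of_int n / of_nat N)"
  define D where "D = cmod (unit_part z - unit_part w)"
  have W: "vortex_lattice N m n = unit_part z"
    using m N unfolding z_def by (intro vortex_lattice_cell) auto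
  have "D \<le> 2"
    unfolding D_def using norm_triangle_ineq4[of "unit_part z" "unit_part w"] by simp
  then have "D^2 \<le> 2^2"
    by (intro power_mono) (auto simp: D_def)
  then have D4: "D^2 \<le> 4" by simp
  have "((2 * (of_int m / of_nat N) - 1)^2 + (2 * (of_int n / of_nat N) - 1)^2) / 8 \<le> (cmod z)^2"
    unfolding z_def using m n N by (intro norm_vortex_ge) auto
  moreover have "2 * (of_int m / of_nat N) - 1 = p / of_nat N" "2 * (of_int n / of_nat N) - 1 = q / of_nat N"
    using N by (simp_all add: p_def q_def field_simps)
  ultimately have "(p^2 + q^2) / (8 * (of_nat N)^2) \<le> (cmod z)^2"
    by (simp add: power_divide add_divide_distrib)
  then have "D^2 * ((p^2 + q^2) / (8 * (of_nat N)^2)) \<le> D^2 * (cmod z)^2"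
    by (rule mult_left_mono) simp
  also have "\<dots> = (D * cmod z)^2" by (simp add: power_mult_distrib)
  also have "\<dots> \<le> (2 * (L / of_nat N))^2"
    using norm_unit_part_diff[of z w] close unfolding D_def z_def[symmetric] by (intro power_mono) auto
  finally have "8 * (of_nat N)^2 * (D^2 * ((p^2 + q^2) / (8 * (of_nat N)^2))) \<le> 8 * (of_nat N)^2 * (2 * (L / of_nat N))^2"
    by (rule mult_left_mono) simp
  then have "D^2 * (p^2 + q^2) \<le> 32 * L^2"
    using N by (simp add: power_divide power_mult_distrib)
  then have "D^2 * (1 + p^2 + q^2) \<le> 4 + 32 * L^2"
    using D4 by (simp add: algebra_simps)
  moreover have "0 < 1 + p^2 + q^2"
    by (rule add_pos_nonneg[OF add_pos_nonneg]) auto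
  ultimately have "D^2 \<le> (4 + 32 * L^2) / (1 + p^2 + q^2)"
    by (simp add: pos_le_divide_eq)
  then show ?thesis
    unfolding W D_def p_def q_def by (simp add: norm_minus_commute)
qed

lemma vortex_lattice_horizontal:
  assumes "m \<in> {0..<int N}" "n \<in> {0..<int N}"
  shows "(cmod (vortex_lattice N (m + 1) n - vortex_lattice N m n))^2
    \<le> 132 / (1 + (of_int (2 * m - int N))^2 + (of_int (2 * n - int N))^2)"
proof -
  have N: "N > 0" using assms by (cases N) auto
  let ?y = "of_int n / of_nat N :: real"
  have "vortex (of_int m / of_nat N) ?y - vortex (of_int (m + 1) / of_nat N) ?y = (1 - ec ?y) / of_nat N"
    using N by (simp add: vortex_def field_simps)
  moreover have "cmod (1 - ec ?y) \<le> 2"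
    using norm_triangle_ineq4[of 1 "ec ?y"] by simp
  ultimately have "cmod (vortex (of_int m / of_nat N) ?y - vortex (of_int (m + 1) / of_nat N) ?y) \<le> 2 / of_nat N"
    by (simp add: norm_divide divide_right_mono)
  \<comment> \<open>\<open>L = 2\<close> gives \<open>4 + 32 * 4 = 132\<close>.\<close>
  from vortex_lattice_diff_le[OF assms _ this] show ?thesis
    using assms N by (subst vortex_lattice_cell[of "m + 1"]) auto
qed

lemma two_pi_le_seven: "2 * pi \<le> 7"
  using pi_approx by simp

lemma vortex_lattice_vertical:
  assumes "m \<in> {0..<int N}" "n \<in> {0..<int N}"
  shows "(cmod (vortex_lattice N m (n + 1) - vortex_lattice N m n))^2
    \<le> 1572 / (1 + (of_int (2 * m - int N))^2 + (of_int (2 * n - int N))^2)"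
proof -
  have N: "N > 0" using assms by (cases N) auto
  let ?x = "of_int m / of_nat N :: real"
  let ?d = "ec (of_int n / of_nat N) - ec (of_int (n + 1) / of_nat N)"
  have "vortex ?x (of_int n / of_nat N) - vortex ?x (of_int (n + 1) / of_nat N) = of_real ?x * ?d"
    by (simp add: vortex_def algebra_simps)
  moreover have "\<bar>?x\<bar> \<le> 1" using assms N by (auto simp: abs_le_iff)
  moreover have "cmod ?d \<le> 7 / of_nat N"
  proof -
    have "cmod ?d \<le> 2 * pi * \<bar>of_int n / of_nat N - of_int (n + 1) / of_nat N\<bar>"
      by (rule norm_ec_diff_le)
    also have "\<dots> = 2 * pi / of_nat N"
      using N by (simp add: diff_divide_distrib[symmetric])
    finally show ?thesis
      using divide_right_mono[OF two_pi_le_seven, of "real N"] by simp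
  qed
  ultimately have "cmod (vortex ?x (of_int n / of_nat N) - vortex ?x (of_int (n + 1) / of_nat N)) \<le> 1 * (7 / of_nat N)"
    unfolding norm_mult norm_of_real by (simp only: norm_mult norm_of_real) (intro mult_mono, auto)
  then have "cmod (vortex ?x (of_int n / of_nat N) - vortex ?x (of_int (n + 1) / of_nat N)) \<le> 7 / of_nat N"
    by simp
  \<comment> \<open>\<open>L = 7\<close>, an integer above \<open>2 * pi\<close>, gives
    \<open>4 + 32 * 49 = 1572\<close>.\<close>
  from vortex_lattice_diff_le[OF assms _ this] show ?thesis
    using assms N by (subst vortex_lattice_cell[of m N "n + 1"]) auto
qed

section \<open>Lattice sums around the centre of the cell\<close>

lemma sum_abs_centred_le:
  fixes g :: "nat \<Rightarrow> real"
  assumes "\<And>k. 0 \<le> g k"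
  shows "(\<Sum>n\<in>{0..<int N}. g (nat \<bar>2 * n - int N\<bar>)) \<le> 2 * (\<Sum>k\<le>N. g k)"
proof -
  let ?h = "\<lambda>n. nat \<bar>2 * n - int N\<bar>"
  have part: "(\<Sum>n\<in>S. g (?h n)) \<le> (\<Sum>k\<le>N. g k)" if inj: "inj_on ?h S" and S: "S \<subseteq> {0..<int N}" for S
  proof -
    have "(\<Sum>n\<in>S. g (?h n)) = sum g (?h ` S)"
      using inj by (simp add: sum.reindex)
    also have "\<dots> \<le> (\<Sum>k\<le>N. g k)"
    proof (rule sum_mono2)
      show "?h ` S \<subseteq> {..N}"
      proof
        fix k assume "k \<in> ?h ` S"
        then obtain n where "k = ?h n" "0 \<le> n" "n < int N" using S by auto
        then show "k \<in> {..N}" by simp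
      qed
    qed (use assms in auto)
    finally show ?thesis .
  qed
  \<comment> \<open>On each side of the centre \<open>N / 2\<close> the map to the distance is
    injective, so every value is taken at most twice.\<close>
  define A B where "A = {n\<in>{0..<int N}. 2 * n < int N}" and "B = {n\<in>{0..<int N}. int N \<le> 2 * n}"
  have "inj_on ?h A"
  proof (rule inj_onI)
    fix x y assume "x \<in> A" "y \<in> A" "?h x = ?h y"
    then have "\<bar>2 * x - int N\<bar> = \<bar>2 * y - int N\<bar>" "2 * x < int N" "2 * y < int N"
      by (simp_all add: A_def eq_nat_nat_iff)
    then show "x = y" by linarith
  qed
  moreover have "inj_on ?h B"
  proof (rule inj_onI)
    fix x y assume "x \<in> B" "y \<in> B" "?h x = ?h y"
    then have "\<bar>2 * x - int N\<bar> = \<bar>2 * y - int N\<bar>" "int N \<le> 2 * x" "int N \<le> 2 * y"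
      by (simp_all add: B_def eq_nat_nat_iff)
    then show "x = y" by linarith
  qed
  moreover have sub: "A \<subseteq> {0..<int N}" "B \<subseteq> {0..<int N}"
    by (auto simp: A_def B_def)
  ultimately have "(\<Sum>n\<in>A. g (?h n)) + (\<Sum>n\<in>B. g (?h n)) \<le> (\<Sum>k\<le>N. g k) + (\<Sum>k\<le>N. g k)"
    by (intro add_mono part)
  moreover have "(\<Sum>n\<in>{0..<int N}. g (?h n)) = (\<Sum>n\<in>A. g (?h n)) + (\<Sum>n\<in>B. g (?h n))"
  proof -
    have "{0..<int N} = A \<union> B" "A \<inter> B = {}"
      by (auto simp: A_def B_def)
    moreover have "finite A" "finite B"
      using sub finite_subset by blast+
    ultimately show ?thesis
      by (simp add: sum.union_disjoint)
  qed
  ultimately show ?thesis by simp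
qed

text \<open>Telescoping, since \<open>1 / t^2 \<le> 2 / (t * (t + 1))\<close> for
  \<open>t \<ge> 1\<close>.\<close>

lemma sum_inverse_squares_le:
  fixes a :: real
  assumes "1 \<le> a"
  shows "(\<Sum>k\<le>N. 1 / (a + of_nat k)^2) \<le> 2 / a"
proof -
  have "(\<Sum>k\<le>N. 1 / (a + of_nat k)^2) \<le> (\<Sum>k\<le>N. 2 / (a + of_nat k) - 2 / (a + of_nat (Suc k)))"
  proof (rule sum_mono)
    fix k
    let ?t = "a + real k"
    have t: "1 \<le> ?t" using assms by simp
    then have "?t * (?t + 1) \<le> ?t * (2 * ?t)" by (intro mult_left_mono) auto
    then have "1 / ?t^2 \<le> 2 / (?t * (?t + 1))"
      using t by (simp add: field_simps power2_eq_square)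
    also have "\<dots> = 2 / ?t - 2 / (?t + 1)"
      using t by (simp add: field_simps)
    finally show "1 / ?t^2 \<le> 2 / ?t - 2 / (a + of_nat (Suc k))"
      by (simp add: add_ac)
  qed
  also have "\<dots> = 2 / a - 2 / (a + of_nat (Suc N))"
    using sum_telescope[of "\<lambda>k. 2 / (a + of_nat k)" N] by simp
  also have "\<dots> \<le> 2 / a" using assms by simp
  finally show ?thesis .
qed

lemma sum_inverse_le_ln: "(\<Sum>k\<le>N. 1 / (1 + real k)) \<le> 1 + ln (1 + real N)"
proof (induction N)
  case (Suc N)
  have "ln (1 + real N) - ln (1 + real (Suc N)) \<le> ((1 + real N) - (1 + real (Suc N))) / (1 + real (Suc N))"
    by (rule ln_diff_le) auto
  also have "\<dots> = - 1 / (1 + real (Suc N))"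
    by simp
  finally show ?case using Suc by simp
qed simp

text \<open>The row at distance \<open>k\<close> from the centre sums to order
  \<open>1 / (1 + k)\<close>, and the rows add up to a harmonic sum, the source of the
  logarithm.\<close>

lemma sum_lattice_inverse_square:
  assumes "2 \<le> N"
  shows "(\<Sum>m\<in>{0..<int N}. \<Sum>n\<in>{0..<int N}.
      1 / (1 + (of_int (2 * m - int N))^2 + (of_int (2 * n - int N))^2)) \<le> 96 * ln (real N)"
proof -
  let ?I = "{0..<int N}" and ?k = "\<lambda>n. nat \<bar>2 * n - int N\<bar>"
  have row: "(\<Sum>n\<in>?I. 1 / (1 + (of_int (2 * m - int N))^2 + (of_int (2 * n - int N))^2))
     \<le> 12 * (1 / (1 + real (?k m)))" for m
  proof -
    let ?a = "1 + real (?k m)"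
    have "1 / (1 + (of_int (2 * m - int N))^2 + (of_int (2 * n - int N))^2) \<le> 3 * (1 / (?a + real (?k n))^2)" for n
    proof -
      have sq: "(of_int (2 * m - int N))^2 = (real (?k m))^2" "(of_int (2 * n - int N))^2 = (real (?k n))^2"
        by simp_all
      have three: "(1 + s + t)^2 \<le> 3 * (1 + s^2 + t^2)" for s t :: real
      proof -
        have "3 * (1 + s^2 + t^2) - (1 + s + t)^2 = (1 - s)^2 + (1 - t)^2 + (s - t)^2"
          by (simp add: power2_eq_square algebra_simps)
        moreover have "0 \<le> (1 - s)^2 + (1 - t)^2 + (s - t)^2" by simp
        ultimately show ?thesis by linarith
      qed
      have "0 < (?a + real (?k n))^2" by (intro zero_less_power) linarith
      moreover have "0 < 1 + (real (?k m))^2 + (real (?k n))^2"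
        by (rule add_pos_nonneg[OF add_pos_nonneg]) auto
      ultimately show ?thesis
        unfolding sq using three[of "real (?k m)" "real (?k n)"] by (simp only: divide_simps) simp
    qed
    then have "(\<Sum>n\<in>?I. 1 / (1 + (of_int (2 * m - int N))^2 + (of_int (2 * n - int N))^2))
      \<le> (\<Sum>n\<in>?I. 3 * (1 / (?a + real (?k n))^2))"
      by (rule sum_mono)
    also have "\<dots> = 3 * (\<Sum>n\<in>?I. 1 / (?a + real (?k n))^2)"
      by (rule sum_distrib_left[symmetric])
    also have "\<dots> \<le> 3 * (2 * (\<Sum>k\<le>N. 1 / (?a + real k)^2))"
      by (intro mult_left_mono sum_abs_centred_le) auto
    also have "\<dots> \<le> 3 * (2 * (2 / ?a))"
      by (intro mult_left_mono sum_inverse_squares_le) auto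
    finally show ?thesis by simp
  qed
  have "(\<Sum>m\<in>?I. \<Sum>n\<in>?I. 1 / (1 + (of_int (2 * m - int N))^2 + (of_int (2 * n - int N))^2))
    \<le> (\<Sum>m\<in>?I. 12 * (1 / (1 + real (?k m))))"
    by (intro sum_mono row)
  also have "\<dots> = 12 * (\<Sum>m\<in>?I. 1 / (1 + real (?k m)))"
    by (rule sum_distrib_left[symmetric])
  also have "\<dots> \<le> 12 * (2 * (\<Sum>k\<le>N. 1 / (1 + real k)))"
    by (intro mult_left_mono sum_abs_centred_le) auto
  also have "\<dots> \<le> 12 * (2 * (1 + ln (1 + real N)))"
    by (intro mult_left_mono sum_inverse_le_ln) auto
  \<comment> \<open>The constant is absorbed thanks to \<open>N \<ge> 2\<close>:
    \<open>1 + N \<le> N^2\<close>, and \<open>1 \<le> 2 * ln N\<close> because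
    \<open>ln 2 \<ge> 2/3\<close>.\<close>
  also have "1 + ln (1 + real N) \<le> 4 * ln (real N)"
  proof -
    have "1 + real N \<le> real N * real N"
    proof -
      have "2 * real N \<le> real N * real N"
        using assms by (intro mult_right_mono) auto
      then show ?thesis using assms by linarith
    qed
    then have "ln (1 + real N) \<le> ln (real N * real N)"
      using assms by (intro ln_mono) auto
    also have "\<dots> = 2 * ln (real N)" using assms by (simp add: ln_mult)
    finally have "ln (1 + real N) \<le> 2 * ln (real N)" .
    moreover have "ln 2 \<le> ln (real N)" using assms by simp
    ultimately show ?thesis using ln2_ge_two_thirds by linarith
  qed
  finally show ?thesis by simp
qed

text \<open>Parseval turns each half into differences of a Zak transform. In the Fourier half,
  \<open>zak_fourier\<close> brings in the phase \<open>ec (m * n / N^2)\<close>, whose change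
  between neighbours remains as the factor \<open>ec (- m / N^2)\<close>.\<close>

lemma gabor_energy_zak:
  assumes "N > 0" "b \<in> ell2 N"
  shows "gabor_energy N b = (\<Sum>m\<in>{0..<int N}. \<Sum>n\<in>{0..<int N}. (cmod (zak N b (m + 1) n - zak N b m n))^2)
    + (\<Sum>m\<in>{0..<int N}. \<Sum>n\<in>{0..<int N}. (cmod (ec (- (of_int m / of_nat (N^2))) * zak N b m (n + 1) - zak N b m n))^2)"
proof -
  let ?I = "{0..<int N}"
  have diff: "of_nat N * diff_energy N c 1 = (\<Sum>m\<in>?I. \<Sum>n\<in>?I. (cmod (zak N c (m + 1) n - zak N c m n))^2)"
    if c: "c \<in> ell2 N" for c
  proof -
    have "(\<lambda>j. c (j + 1) - c j) \<in> ell2 N"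
      using c ell2_shift[OF c, of 1] by (simp add: ell2_def)
    moreover have "zak N (\<lambda>j. c (j + 1) - c j) m n = zak N c (m + 1) n - zak N c m n" for m n
    proof -
      have "m + 1 - int N * k = m - int N * k + 1" for k by simp
      then show ?thesis by (simp add: zak_def sum_subtractf algebra_simps)
    qed
    ultimately show ?thesis
      using zak_parseval[OF assms(1), of "\<lambda>j. c (j + 1) - c j"] by (simp add: diff_energy_def)
  qed
  let ?Y = "zak N (fourier_d N b)"
  have "(\<Sum>m\<in>?I. \<Sum>n\<in>?I. (cmod (?Y (m + 1) n - ?Y m n))^2)
      = (\<Sum>m\<in>?I. \<Sum>n\<in>?I. (cmod (?Y (m + 1) (0 - n) - ?Y m (0 - n)))^2)"
    by (rule sum.cong[OF refl], rule sum_periodic_reflect[symmetric])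
      (use assms in \<open>simp_all add: zak_periodic\<close>)
  also have "\<dots> = (\<Sum>m\<in>?I. \<Sum>n\<in>?I. (cmod (ec (- (of_int n / of_nat (N^2))) * zak N b n (m + 1) - zak N b n m))^2)"
  proof (intro sum.cong refl)
    fix m n
    have "of_int (m + 1) * of_int (0 - n) / of_nat (N^2)
      = of_int m * of_int (0 - n) / of_nat (N^2) + - (of_int n / (of_nat (N^2) :: real))"
      by (simp add: add_divide_distrib diff_divide_distrib ring_distribs)
    then have "?Y (m + 1) (0 - n) - ?Y m (0 - n) = ec (of_int m * of_int (0 - n) / of_nat (N^2))
      * (ec (- (of_int n / of_nat (N^2))) * zak N b n (m + 1) - zak N b n m)"
      unfolding zak_fourier[OF assms] by (simp only: ec_add) (simp add: algebra_simps)
    then show "(cmod (?Y (m + 1) (0 - n) - ?Y m (0 - n)))^2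
      = (cmod (ec (- (of_int n / of_nat (N^2))) * zak N b n (m + 1) - zak N b n m))^2"
      by (simp only: norm_mult norm_ec mult_1)
  qed
  also have "\<dots> = (\<Sum>m\<in>?I. \<Sum>n\<in>?I. (cmod (ec (- (of_int m / of_nat (N^2))) * zak N b m (n + 1) - zak N b m n))^2)"
    by (rule sum.swap)
  finally show ?thesis
    unfolding gabor_energy_def norm_d_Delta[OF assms(1)] diff[OF assms(2)] diff[OF fourier_d_ell2[OF assms(1)]]
    by simp
qed

text \<open>The twist \<open>ec (- m / N^2)\<close> is within \<open>7 / N\<close> of 1, so over all
  \<open>N^2\<close> points it adds only a bounded amount, here 98.\<close>

lemma vortex_window_energy:
  assumes "2 \<le> N"
  shows "gabor_energy N (vortex_window N) \<le> 320000 * ln (real N)"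
proof -
  have N: "N > 0" using assms by simp
  let ?I = "{0..<int N}" and ?W = "vortex_lattice N"
  let ?r = "\<lambda>m n. 1 / (1 + (of_int (2 * m - int N))^2 + (of_int (2 * n - int N))^2) :: real"
  let ?S = "\<Sum>m\<in>?I. \<Sum>n\<in>?I. ?r m n"
  have "(\<Sum>m\<in>?I. \<Sum>n\<in>?I. (cmod (?W (m + 1) n - ?W m n))^2) \<le> (\<Sum>m\<in>?I. \<Sum>n\<in>?I. 132 * ?r m n)"
    by (intro sum_mono) (use vortex_lattice_horizontal in simp)
  also have "\<dots> = 132 * ?S" by (simp add: sum_distrib_left)
  finally have hor: "(\<Sum>m\<in>?I. \<Sum>n\<in>?I. (cmod (?W (m + 1) n - ?W m n))^2) \<le> 132 * ?S" .
  have "(cmod (ec (- (of_int m / of_nat (N^2))) * ?W m (n + 1) - ?W m n))^2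
    \<le> 3144 * ?r m n + 98 / (of_nat N)^2" if mn: "m \<in> ?I" "n \<in> ?I" for m n
  proof -
    let ?e = "ec (- (of_int m / of_nat (N^2)))"
    let ?x = "cmod (?W m (n + 1) - ?W m n)"
    have "cmod (?e * ?W m (n + 1) - ?W m n) = cmod ((?e - ec 0) * ?W m (n + 1) + (?W m (n + 1) - ?W m n))"
      by (simp add: algebra_simps)
    also have "\<dots> \<le> cmod ((?e - ec 0) * ?W m (n + 1)) + ?x"
      by (rule norm_triangle_ineq)
    also have "cmod ((?e - ec 0) * ?W m (n + 1)) = cmod (?e - ec 0)"
      by (simp add: norm_mult norm_vortex_lattice)
    finally have tri: "cmod (?e * ?W m (n + 1) - ?W m n) \<le> cmod (?e - ec 0) + ?x" .
    have "cmod (?e - ec 0) \<le> 2 * pi * \<bar>- (of_int m / of_nat (N^2)) - 0\<bar>"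
      by (rule norm_ec_diff_le)
    also have "\<dots> \<le> 7 * (1 / of_nat N)"
    proof (rule mult_mono[OF two_pi_le_seven])
      have "of_int m / of_nat (N^2) \<le> of_nat N / (of_nat (N^2) :: real)"
        using mn by (intro divide_right_mono) auto
      then show "\<bar>- (of_int m / of_nat (N^2)) - 0\<bar> \<le> 1 / real N"
        using mn N by (simp add: power2_eq_square)
    qed auto
    finally have "cmod (?e * ?W m (n + 1) - ?W m n) \<le> 7 / of_nat N + ?x"
      using tri by simp
    then have "(cmod (?e * ?W m (n + 1) - ?W m n))^2 \<le> (7 / of_nat N + ?x)^2"
      by (intro power_mono) auto
    also have "\<dots> \<le> 2 * (7 / of_nat N)^2 + 2 * ?x^2"
      using sum_squares_bound[of "7 / of_nat N" ?x] by (simp add: power2_sum)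
    also have "?x^2 \<le> 1572 * ?r m n"
      using vortex_lattice_vertical[OF mn] by simp
    finally show ?thesis by (simp add: power_divide)
  qed
  then have "(\<Sum>m\<in>?I. \<Sum>n\<in>?I. (cmod (ec (- (of_int m / of_nat (N^2))) * ?W m (n + 1) - ?W m n))^2)
    \<le> (\<Sum>m\<in>?I. \<Sum>n\<in>?I. 3144 * ?r m n + 98 / (of_nat N)^2)"
    by (intro sum_mono) blast
  also have "\<dots> = 3144 * ?S + 98"
    using N by (simp add: sum.distrib sum_distrib_left power2_eq_square)
  finally have "gabor_energy N (vortex_window N) \<le> 132 * ?S + (3144 * ?S + 98)"
    unfolding gabor_energy_zak[OF N vortex_window_ell2[OF N]] zak_vortex_window[OF N]
    using hor by (intro add_mono) auto
  moreover have "?S \<le> 96 * ln (real N)"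
    by (rule sum_lattice_inverse_square[OF assms])
  moreover have "ln 2 \<le> ln (real N)" using assms by simp
  \<comment> \<open>\<open>(132 + 3144) * 96 = 314496\<close> and
    \<open>98 \<le> 147 * ln N\<close>, which together stay below 320000.\<close>
  ultimately show ?thesis using ln2_ge_two_thirds by linarith
qed

section \<open>Bounds for the infimum over all Gabor orthonormal bases\<close>

theorem theorem1p1:
  "(\<exists>c C :: real. c > 0 \<and> C > 0 \<and>
      (\<forall>N::nat. N \<ge> 2 \<longrightarrow> c * ln (real N) \<le> alpha N \<and> alpha N \<le> C * ln (real N)))
   \<and> filterlim alpha at_top sequentially"
proof -
  let ?A = "\<lambda>N. {gabor_energy N b | b. b \<in> ell2 N \<and> orthonormal_basis_d N (NZ N \<times> NZ N) (gabor N b)}"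
  have alpha: "alpha N = Inf (?A N)" for N
    unfolding alpha_def gabor_energy_def ..
  have lower: "ln (real N) / 2176 \<le> e" if "2 \<le> N" "e \<in> ?A N" for N e
    using that gabor_energy_lower_bound gabor_basis_iff by auto
  have window: "gabor_energy N (vortex_window N) \<in> ?A N" if "2 \<le> N" for N
  proof -
    have N: "N > 0" using that by simp
    have b: "vortex_window N \<in> ell2 N"
      by (rule vortex_window_ell2[OF N])
    then have "orthonormal_basis_d N (NZ N \<times> NZ N) (gabor N (vortex_window N))"
      by (simp add: gabor_basis_iff[OF N] zak_vortex_window[OF N] norm_vortex_lattice)
    then show ?thesis using b by blast
  qed
  have lo: "1 / 2176 * ln (real N) \<le> alpha N" if "2 \<le> N" for N
  proof -
    have "ln (real N) / 2176 \<le> Inf (?A N)"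
      \<comment> \<open>The window makes the set non-empty, so a common lower bound of its elements
        passes to the infimum.\<close>
      using window[OF that] lower[OF that] by (intro cInf_greatest) blast+
    then show ?thesis by (simp add: alpha)
  qed
  have hi: "alpha N \<le> 320000 * ln (real N)" if "2 \<le> N" for N
  proof -
    have "bdd_below (?A N)"
      using lower[OF that] by (rule bdd_belowI)
    then have "Inf (?A N) \<le> gabor_energy N (vortex_window N)"
      by (intro cInf_lower window[OF that])
    then show ?thesis
      using vortex_window_energy[OF that] by (simp add: alpha)
  qed
  have "filterlim (\<lambda>N. 1 / 2176 * ln (real N)) at_top sequentially"
    by (intro filterlim_tendsto_pos_mult_at_top[OF tendsto_const]
        filterlim_compose[OF ln_at_top] filterlim_real_sequentially) simp
  then have "filterlim alpha at_top sequentially"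
    by (rule filterlim_at_top_mono) (rule eventually_mono[OF eventually_ge_at_top[of 2] lo])
  moreover have "\<exists>c C :: real. c > 0 \<and> C > 0 \<and>
      (\<forall>N::nat. N \<ge> 2 \<longrightarrow> c * ln (real N) \<le> alpha N \<and> alpha N \<le> C * ln (real N))"
    using lo hi by (intro exI[of _ "1 / 2176"] exI[of _ 320000]) auto
  ultimately show ?thesis by blast
qed

end
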